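(* Let $n\ge2$. For every vertex-labeled tree $T$ on $[n]$, equipped with its cyclic embedding, $\mathsf r^T$ is a cyclic factorization of $\lambda_n$, and the map $T\mapsto \mathsf r^T$ is a bijection from the set of vertex-labeled trees on $[n]$ onto the set of cyclic factorizations of $\lambda_n$.
   Context: The affine symmetric group $\widetilde S_n$ is the group, under composition, of bijections $w:\mathbb Z\to\mathbb Z$ with $w(i+n)=w(i)+n$ and $\sum_{i=1}^n w(i)=\binom{n+1}{2}$. For $i\not\equiv j\pmod n$, $(\!(i,j)\!)$ is the affine reflection interchanging $i+kn$ and $j+kn$ for all $k\in\mathbb Z$; $(\!(i,j)\!)=(\!(j,i)\!)=(\!(i+kn,j+kn)\!)$. "$i\bmod n$" denotes the representative of $i$ modulo $n$ in $\{1,\dots,n\}$. Let $\lambda_n$ be the element with $\lambda_n(k)=k+n$ for $k\not\equiv0\pmod n$ and $\lambda_n(k)=k-n(n-1)$ for $k\equiv 0\pmod n$; its reflection length is $2n-2$. $\textsc{fact}(\lambda_n)$ is the set of sequences $[r_1,\dots,r_{2n-2}]$ of reflections with $r_1\cdots r_{2n-2}=\lambda_n$. Such a sequence is tree-like if one can write $r_i=(\!(a_{i-1},b_i)\!)$ with integers $a_{i-1}<b_i$ ($1\le i\le 2n-2$) and $a_i\equiv b_i\pmod n$ ($1\le i\le 2n-3$). For such $\mathsf r$ and $k\in[n]$, $N_{\mathsf r}(k)$ is the list, in increasing order of $i$, of $b_i\bmod n$ over all $i$ with $a_{i-1}\equiv k\pmod n$. A tree-like $\mathsf r$ is cyclic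 if (i) $N_{\mathsf r}(n)$ is strictly increasing and (ii) for each $1\le k<n$, writing $N_{\mathsf r}(k)=[c_1,\dots,c_\ell]$, there is $1\le j\le\ell$ with $c_j<\dots<c_{\ell-1}<k<c_1<\dots<c_{j-1}$. Cyclic embedding of a tree $T$ with vertex set $[n]$: embed $T$ in the plane so that around each vertex $i$ the neighbors, read clockwise, have cyclically increasing values, where each neighbor has value equal to its label except that, for $i\ne n$, the neighbor of $i$ on the unique path from $i$ to $n$ is given the value $i$; the marked edge is the edge from $n$ to its smallest neighbor. For a plane-embedded tree with marked edge at $n$, the clockwise walk starts at $n$, traverses the marked edge first, and thereafter, upon arriving at a vertex $v$ along edge $e$, leaves along the edge immediately following $e$ clockwise around $v$ (at a leaf, $e$ itself); it visits $v_0=n,v_1,\dots,v_{2n-2}=n$, traversing each edge twice. Then $\mathsf r^T=[t_1,\dots,t_{2n-2}]$ with $t_k=(\!(v_{k-1},v_k)\!)$ if $v_{k-1}<v_k$ and $t_k=(\!(v_{k-1}-n,v_k)\!)$ if $v_{k-1}>v_k$. *)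

theory Defs
  imports Main
begin

section \<open>Affine symmetric group: reflections, lambda_n, factorizations\<close>

text \<open>Representative of i modulo n in {1..n}.\<close>
definition md :: "nat \<Rightarrow> int \<Rightarrow> int" where
  "md n i = (i - 1) mod int n + 1"

text \<open>The affine reflection ((i,j)) (for i, j not congruent mod n):
  interchanges i+kn and j+kn for all k.\<close>
definition arefl :: "nat \<Rightarrow> int \<Rightarrow> int \<Rightarrow> (int \<Rightarrow> int)" where
  "arefl n i j = (\<lambda>x. if x mod int n = i mod int n then x - i + j
                      else if x mod int n = j mod int n then x - j + i
                      else x)"

definition is_refl :: "nat \<Rightarrow> (int \<Rightarrow> int) \<Rightarrow> bool" where
  "is_refl n r \<longleftrightarrow> (\<exists>i j. i mod int n \<noteq> j mod int n \<and> r = arefl n i j)"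

definition lam :: "nat \<Rightarrow> int \<Rightarrow> int" where
  "lam n k = (if k mod int n \<noteq> 0 then k + int n else k - int n * (int n - 1))"

text \<open>Product r_1 ... r_m in the group under composition.\<close>
definition prodr :: "(int \<Rightarrow> int) list \<Rightarrow> (int \<Rightarrow> int)" where
  "prodr rs = foldr (\<circ>) rs id"

text \<open>fact(lambda_n): sequences of 2n-2 reflections with product lambda_n.\<close>
definition is_fact :: "nat \<Rightarrow> (int \<Rightarrow> int) list \<Rightarrow> bool" where
  "is_fact n rs \<longleftrightarrow> length rs = 2 * n - 2 \<and> (\<forall>r \<in> set rs. is_refl n r) \<and> prodr rs = lam n"

text \<open>Witnesses a_0..a_{m-1}, b_1..b_m (m = length rs) for tree-likeness:
  r_i = ((a_{i-1}, b_i)), a_{i-1} < b_i, and a_i = b_i mod n for 1 <= i <= m-1.\<close>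
definition tree_like_wit :: "nat \<Rightarrow> (int \<Rightarrow> int) list \<Rightarrow> (nat \<Rightarrow> int) \<Rightarrow> (nat \<Rightarrow> int) \<Rightarrow> bool" where
  "tree_like_wit n rs a b \<longleftrightarrow>
     (\<forall>i\<in>{1..length rs}. a (i - 1) < b i \<and> a (i - 1) mod int n \<noteq> b i mod int n
                          \<and> rs ! (i - 1) = arefl n (a (i - 1)) (b i)) \<and>
     (\<forall>i\<in>{1..<length rs}. a i mod int n = b i mod int n)"

definition tree_like :: "nat \<Rightarrow> (int \<Rightarrow> int) list \<Rightarrow> bool" where
  "tree_like n rs \<longleftrightarrow> (\<exists>a b. tree_like_wit n rs a b)"

text \<open>N_r(k): list, in increasing order of i, of (b_i mod n) over i with a_{i-1} = k mod n.\<close>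
definition Nlist :: "nat \<Rightarrow> nat \<Rightarrow> (nat \<Rightarrow> int) \<Rightarrow> (nat \<Rightarrow> int) \<Rightarrow> int \<Rightarrow> int list" where
  "Nlist n m a b k = map (\<lambda>i. md n (b i)) (filter (\<lambda>i. a (i - 1) mod int n = k mod int n) [1..<m+1])"

text \<open>Condition (ii) for a list [c_1,...,c_l] and k: exists 1 <= j <= l with
  c_j < ... < c_{l-1} < k < c_1 < ... < c_{j-1}.\<close>
definition cyc_cond :: "int list \<Rightarrow> int \<Rightarrow> bool" where
  "cyc_cond cs k \<longleftrightarrow> (\<exists>j. 1 \<le> j \<and> j \<le> length cs \<and>
      sorted_wrt (<) (drop (j - 1) (take (length cs - 1) cs) @ [k] @ take (j - 1) cs))"

definition cyclic_fact :: "nat \<Rightarrow> (int \<Rightarrow> int) list \<Rightarrow> bool" where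
  "cyclic_fact n rs \<longleftrightarrow> is_fact n rs \<and>
     (\<exists>a b. tree_like_wit n rs a b \<and>
        sorted_wrt (<) (Nlist n (length rs) a b (int n)) \<and>
        (\<forall>k::nat. 1 \<le> k \<and> k < n \<longrightarrow> cyc_cond (Nlist n (length rs) a b (int k)) (int k)))"

section \<open>Labeled trees on [n] and their cyclic embedding\<close>

definition adj :: "nat set set \<Rightarrow> (nat \<times> nat) set" where
  "adj E = {(u, v). {u, v} \<in> E}"

text \<open>A tree on vertex set {1..n}: simple graph (edges are 2-subsets of [n]),
  connected, with n-1 edges.\<close>
definition is_tree :: "nat \<Rightarrow> nat set set \<Rightarrow> bool" where
  "is_tree n E \<longleftrightarrow>
     (\<forall>e\<in>E. \<exists>u v. e = {u, v} \<and> u \<noteq> v \<and> u \<in> {1..n} \<and> v \<in> {1..n}) \<and>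
     (\<forall>u\<in>{1..n}. \<forall>v\<in>{1..n}. (u, v) \<in> (adj E)\<^sup>*) \<and>
     card E = n - 1"

definition nbrs :: "nat set set \<Rightarrow> nat \<Rightarrow> nat set" where
  "nbrs E v = {u. {u, v} \<in> E}"

text \<open>Neighbor of v on the unique path from v to n.\<close>
definition parent :: "nat \<Rightarrow> nat set set \<Rightarrow> nat \<Rightarrow> nat" where
  "parent n E v = (THE u. {u, v} \<in> E \<and> (u, n) \<in> (adj (E - {{u, v}}))\<^sup>*)"

text \<open>Value of neighbor u around vertex v in the cyclic embedding.\<close>
definition nval :: "nat \<Rightarrow> nat set set \<Rightarrow> nat \<Rightarrow> nat \<Rightarrow> nat" where
  "nval n E v u = (if v \<noteq> n \<and> u = parent n E v then v else u)"

text \<open>Neighbor immediately following u clockwise around v (cyclically next value).\<close>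
definition cw_next :: "nat \<Rightarrow> nat set set \<Rightarrow> nat \<Rightarrow> nat \<Rightarrow> nat" where
  "cw_next n E v u =
     (if \<exists>x\<in>nbrs E v. nval n E v x > nval n E v u
      then (THE x. x \<in> nbrs E v \<and> nval n E v x > nval n E v u \<and>
              (\<forall>y\<in>nbrs E v. nval n E v y > nval n E v u \<longrightarrow> nval n E v x \<le> nval n E v y))
      else (THE x. x \<in> nbrs E v \<and> (\<forall>y\<in>nbrs E v. nval n E v x \<le> nval n E v y)))"

text \<open>Clockwise walk v_0 = n, v_1 = smallest neighbor of n (marked edge), ...\<close>
fun cw_walk :: "nat \<Rightarrow> nat set set \<Rightarrow> nat \<Rightarrow> nat" where
  "cw_walk n E 0 = n"
| "cw_walk n E (Suc 0) = Min (nbrs E n)"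
| "cw_walk n E (Suc (Suc k)) = cw_next n E (cw_walk n E (Suc k)) (cw_walk n E k)"

definition rT_step :: "nat \<Rightarrow> nat \<Rightarrow> nat \<Rightarrow> (int \<Rightarrow> int)" where
  "rT_step n x y = (if x < y then arefl n (int x) (int y) else arefl n (int x - int n) (int y))"

definition rT :: "nat \<Rightarrow> nat set set \<Rightarrow> (int \<Rightarrow> int) list" where
  "rT n E = map (\<lambda>k. rT_step n (cw_walk n E (k - 1)) (cw_walk n E k)) [1..<2 * n - 1]"

end

theory Submission
  imports Defs
begin

text \<open>Read the product r_1 ... r_{2n-2} of a tree-like factorization from right to left and follow
  the residue classes. The class of b_{2n-2} takes part in every factor and strictly decreases, so it
  is the class of n, and the sequence a_0, b_1, ..., b_{2n-2} is a closed walk from n. Every other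
  class moves only when the walk meets it, always upwards and by n in total, hence at least twice;
  as there are only 2n - 2 factors, each class moves exactly twice, from k to some x and back. So the
  walk uses the n - 1 edges {k, x}, once in either direction: it is an Euler tour of a tree, and all
  steps have length below n. Conversely, an Euler tour of a tree visits the subtree of k during one
  time interval, so the class of k moves to its parent and back, and the product is lambda_n.
  In a tree, a walk leaving a vertex towards a child returns from that child. Therefore the list
  N_r(k) of departures lists the neighbours of k, for k < n with the parent last, and the two cyclicity conditions say
  exactly that the tour turns clockwise at every vertex.\<close>

section \<open>Trees, bridges and Euler tours\<close>

text \<open>The two sides of the bijection meet in the locale \<open>tour\<close>: a closed walk
  from \<open>n\<close> that uses every dart (edge with a direction) exactly once. The clockwise
  walk of a tree and the index walk of a tree-like factorization are both shown to be tours.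
  \<open>clockwise_iff\<close> is proved for an arbitrary tour, so it serves both directions. A
  reflection is symmetric in its two points, but written with \<open>a < b\<close> it raises the
  class of \<open>a\<close> and lowers that of \<open>b\<close>. So the factors determine the walk,
  and thereby the tree. That \<open>b - a < n\<close> is not part of tree-likeness: it follows
  because the two moves of a class have positive lengths with sum \<open>n\<close>. A class cannot
  get through with one move because that move would have length \<open>n\<close> and stay inside its
  class, whereas a reflection exchanges distinct classes. The tree is recognized by counting: the
  pairs of moves give at most \<open>n - 1\<close> edges, connectedness gives at least that
  many.\<close>

lemma adj_iff [simp]: "(u, v) \<in> adj E \<longleftrightarrow> {u, v} \<in> E"
  by (simp add: adj_def)

lemma sym_adj: "sym (adj E)"
  by (auto simp: sym_def insert_commute)

lemma adj_rtrancl_sym: "(u, v) \<in> (adj E)\<^sup>* \<Longrightarrow> (v, u) \<in> (adj E)\<^sup>*"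
  using sym_adj sym_rtrancl by (metis symD)

lemma rtrancl_closed:
  assumes "(x, y) \<in> R\<^sup>*" "x \<in> S" "\<And>a b. a \<in> S \<Longrightarrow> (a, b) \<in> R \<Longrightarrow> b \<in> S"
  shows "y \<in> S"
  using assms(1,2) by (induction rule: rtrancl_induct) (auto intro: assms(3))

text \<open>With \<open>d\<close> the distance to \<open>r\<close>, each \<open>v\<close> other than
  \<open>r\<close> has a neighbour \<open>p v\<close> closer to \<open>r\<close>. The edges
  \<open>{v, p v}\<close> are distinct: if two of them coincided, each of their ends would be
  strictly closer than the other. The bound yields both the bridge property and the edge count of
  the walk's graph.\<close>

lemma card_vertices_le_Suc_card_edges:
  assumes "finite E" "finite V" "r \<in> V" and reach: "\<And>v. v \<in> V \<Longrightarrow> (v, r) \<in> (adj E)\<^sup>*"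
  shows "card V \<le> Suc (card E)"
proof -
  define d where "d v = (LEAST k. (v, r) \<in> adj E ^^ k)" for v
  have "\<exists>p. {v, p} \<in> E \<and> d p < d v" if v: "v \<in> V - {r}" for v
  proof -
    have ex: "\<exists>k. (v, r) \<in> adj E ^^ k"
      using reach v rtrancl_imp_relpow by blast
    have dv: "(v, r) \<in> adj E ^^ d v"
      unfolding d_def using ex by (rule LeastI_ex)
    have "d v \<noteq> 0"
      using dv v by (metis DiffD2 pair_in_Id_conv relpow.simps(1) singletonI)
    then obtain k where k: "d v = Suc k" using not0_implies_Suc by blast
    then obtain p where "{v, p} \<in> E" "(p, r) \<in> adj E ^^ k"
      using dv relpow_Suc_D2 by (metis adj_iff)
    moreover from this have "d p \<le> k"
      unfolding d_def by (simp add: Least_le)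
    ultimately show ?thesis using k by auto
  qed
  then obtain p where p: "\<And>v. v \<in> V - {r} \<Longrightarrow> {v, p v} \<in> E \<and> d (p v) < d v"
    by metis
  have "inj_on (\<lambda>v. {v, p v}) (V - {r})"
  proof (rule inj_onI)
    fix v v' assume "v \<in> V - {r}" "v' \<in> V - {r}" "{v, p v} = {v', p v'}"
    then show "v = v'"
      using p[of v] p[of v'] by (auto simp: doubleton_eq_iff)
  qed
  then have "card (V - {r}) \<le> card E"
    using p assms(1) by (intro card_inj_on_le) auto
  then show ?thesis using assms(2,3) by (simp add: card_Diff_singleton_if)
qed

lemma exit_step:
  fixes i j :: nat
  assumes "P (w i)" "\<not> P (w j)" "i \<le> j"
  obtains t where "i \<le> t" "t < j" "P (w t)" "\<not> P (w (Suc t))"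
proof -
  have "\<exists>t. i \<le> t \<and> t < j \<and> P (w t) \<and> \<not> P (w (Suc t))"
    using assms(3,2)
  proof (induction j rule: dec_induct)
    case base
    then show ?case using assms(1) by simp
  next
    case (step j)
    then show ?case by (cases "P (w j)") (auto intro: less_SucI)
  qed
  then show ?thesis using that by blast
qed

section \<open>Labeled trees: bridges, parents and subtrees\<close>

locale labeled_tree =
  fixes n :: nat and E :: "nat set set"
  assumes n_ge: "2 \<le> n" and tree: "is_tree n E"
begin

lemma edgeD:
  assumes "{u, v} \<in> E"
  shows "u \<noteq> v" "u \<in> {1..n}" "v \<in> {1..n}"
proof -
  have "\<exists>a b. {u, v} = {a, b} \<and> a \<noteq> b \<and> a \<in> {1..n} \<and> b \<in> {1..n}"
    using tree assms unfolding is_tree_def by metis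
  then show "u \<noteq> v" "u \<in> {1..n}" "v \<in> {1..n}"
    unfolding doubleton_eq_iff by blast+
qed

lemma card_E: "card E = n - 1"
  using tree by (simp add: is_tree_def)

lemma finite_E: "finite E"
  using card_E n_ge by (intro card_ge_0_finite) simp

lemma connected: "u \<in> {1..n} \<Longrightarrow> v \<in> {1..n} \<Longrightarrow> (u, v) \<in> (adj E)\<^sup>*"
  using tree by (simp add: is_tree_def)

text \<open>A detour from \<open>u\<close> to \<open>v\<close> would replace the deleted edge in
  every path, so \<open>n - 2\<close> edges would still connect \<open>n\<close> vertices.\<close>

lemma bridge:
  assumes e: "{u, v} \<in> E"
  shows "(u, v) \<notin> (adj (E - {{u, v}}))\<^sup>*"
proof
  let ?R = "adj (E - {{u, v}})"
  assume uv: "(u, v) \<in> ?R\<^sup>*"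
  have "(a, b) \<in> ?R\<^sup>*" if "{a, b} \<in> E" for a b
  proof (cases "{a, b} = {u, v}")
    case True
    then show ?thesis using uv adj_rtrancl_sym by (auto simp: doubleton_eq_iff)
  next
    case False
    then show ?thesis using that by (intro r_into_rtrancl) simp
  qed
  then have "adj E \<subseteq> ?R\<^sup>*" by auto
  then have sub: "(adj E)\<^sup>* \<subseteq> ?R\<^sup>*" using rtrancl_subset_rtrancl by blast
  have "card {1..n} \<le> Suc (card (E - {{u, v}}))"
    by (rule card_vertices_le_Suc_card_edges[where r = n])
      (use finite_E n_ge connected sub in auto)
  then show False using card_E n_ge e finite_E by (simp add: card_Diff_singleton_if)
qed

definition comp :: "nat \<Rightarrow> nat \<Rightarrow> nat set" where
  "comp u v = {x. (v, x) \<in> (adj (E - {{u, v}}))\<^sup>*}"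

lemma comp_self: "v \<in> comp u v"
  by (simp add: comp_def)

lemma comp_other: "{u, v} \<in> E \<Longrightarrow> u \<notin> comp u v"
  unfolding comp_def by (metis adj_rtrancl_sym bridge mem_Collect_eq)

text \<open>Every other edge survives the deletion and hence stays on one side; only the bridge
  leads out. All later arguments on when a walk enters or leaves a subtree rest on this.\<close>

lemma comp_exit:
  assumes "{u, v} \<in> E" "{x, y} \<in> E" "x \<in> comp u v" "y \<notin> comp u v"
  shows "x = v \<and> y = u"
proof (cases "{x, y} = {u, v}")
  case True
  then show ?thesis using assms comp_other by (auto simp: doubleton_eq_iff)
next
  case False
  then have "(x, y) \<in> adj (E - {{u, v}})" using assms by simp
  then have "y \<in> comp u v" using assms(3) unfolding comp_def
    by (metis mem_Collect_eq rtrancl.rtrancl_into_rtrancl)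
  then show ?thesis using assms(4) by simp
qed

lemma comp_cover:
  assumes "{u, v} \<in> E"
  shows "n \<in> comp u v \<or> n \<in> comp v u"
proof -
  have e': "{v, u} \<in> E" using assms by (simp add: insert_commute)
  have "n \<in> comp u v \<union> comp v u"
  proof (rule rtrancl_closed)
    show "(v, n) \<in> (adj E)\<^sup>*" using edgeD[OF assms] n_ge by (intro connected) auto
    show "v \<in> comp u v \<union> comp v u" using comp_self by blast
    show "b \<in> comp u v \<union> comp v u" if "a \<in> comp u v \<union> comp v u" "(a, b) \<in> adj E" for a b
      using that comp_exit[OF assms, of a b] comp_exit[OF e', of a b] comp_self by auto
  qed
  then show ?thesis by blast
qed

text \<open>Makes the description in \<open>parent\<close> well defined. If \<open>u'\<close>
  differs from \<open>u\<close>, it lies on the side of \<open>v\<close> with respect to the edge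
  \<open>{u, v}\<close>. A path from \<open>u'\<close> to \<open>n\<close> without the edge
  \<open>{u', v}\<close> never meets \<open>v\<close>, the only exit from that side, although
  \<open>n\<close> lies on the other one.\<close>

lemma parent_unique:
  assumes "{u, v} \<in> E" "(u, n) \<in> (adj (E - {{u, v}}))\<^sup>*"
    and "{u', v} \<in> E" "(u', n) \<in> (adj (E - {{u', v}}))\<^sup>*"
  shows "u = u'"
proof (rule ccontr)
  assume ne: "u \<noteq> u'"
  have nS: "n \<notin> comp u v"
  proof
    assume "n \<in> comp u v"
    then have "(u, v) \<in> (adj (E - {{u, v}}))\<^sup>*"
      unfolding comp_def using assms(2) adj_rtrancl_sym by (metis mem_Collect_eq rtrancl_trans)
    then show False using bridge assms(1) by blast
  qed
  have "(v, u') \<in> adj (E - {{u, v}})"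
    using assms(3) ne by (auto simp: doubleton_eq_iff insert_commute)
  then have u'S: "u' \<in> comp u v" unfolding comp_def by blast
  have u'n: "n \<in> comp v u'"
    using assms(4) by (simp add: comp_def insert_commute)
  have vu': "v \<notin> comp v u'" using comp_other assms(3) by (simp add: insert_commute)
  have "n \<in> comp u v \<inter> comp v u'"
  proof (rule rtrancl_closed)
    show "(u', n) \<in> (adj (E - {{v, u'}}))\<^sup>*" using assms(4) by (simp add: insert_commute)
    show "u' \<in> comp u v \<inter> comp v u'" using u'S comp_self by simp
    fix a b assume a: "a \<in> comp u v \<inter> comp v u'" and ab: "(a, b) \<in> adj (E - {{v, u'}})"
    then have "b \<in> comp v u'" unfolding comp_def
      by (metis IntD2 comp_def mem_Collect_eq rtrancl.rtrancl_into_rtrancl)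
    moreover have "a \<noteq> v" using a vu' by auto
    ultimately show "b \<in> comp u v \<inter> comp v u'"
      using comp_exit[OF assms(1), of a b] a ab by auto
  qed
  then show False using nS by simp
qed

lemma parentI:
  assumes "{u, v} \<in> E" "n \<in> comp v u"
  shows "parent n E v = u" "v \<noteq> n"
proof -
  have u: "(u, n) \<in> (adj (E - {{u, v}}))\<^sup>*"
    using assms(2) by (simp add: comp_def insert_commute)
  show "parent n E v = u"
    unfolding parent_def using parent_unique assms(1) u by (intro the_equality) blast+
  show "v \<noteq> n" using assms comp_other[of v u] by (auto simp: insert_commute)
qed

lemma edge_cases:
  assumes "{u, v} \<in> E"
  obtains "v \<noteq> n" "u = parent n E v" | "u \<noteq> n" "v = parent n E u"
  using comp_cover[OF assms] parentI[of u v] parentI[of v u] assms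
  by (metis insert_commute)

lemma parent_edge:
  assumes k: "k \<in> {1..<n}"
  shows "{parent n E k, k} \<in> E" "n \<in> comp k (parent n E k)"
proof -
  \<comment> \<open>The steps that do not enter \<open>k\<close>. A neighbour of \<open>k\<close>
    reached from \<open>n\<close> by such steps is reached without any edge at \<open>k\<close>, so
    it is the parent. Without such a neighbour the reachable set would be closed under
    \<open>adj E\<close>, and \<open>k\<close> cut off from \<open>n\<close>.\<close>
  let ?R = "{(x, y). {x, y} \<in> E \<and> y \<noteq> k}"
  have "\<exists>u. {u, k} \<in> E \<and> (n, u) \<in> ?R\<^sup>*"
  proof (rule ccontr)
    assume no: "\<not> ?thesis"
    have "k \<in> {u. (n, u) \<in> ?R\<^sup>* \<and> u \<noteq> k}"
    proof (rule rtrancl_closed)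
      show "(n, k) \<in> (adj E)\<^sup>*" using k by (intro connected) auto
      show "n \<in> {u. (n, u) \<in> ?R\<^sup>* \<and> u \<noteq> k}" using k by simp
      fix a b assume a: "a \<in> {u. (n, u) \<in> ?R\<^sup>* \<and> u \<noteq> k}" and ab: "(a, b) \<in> adj E"
      have "b \<noteq> k" using a ab no by auto
      then have "(n, b) \<in> ?R\<^sup>*" using a ab by (auto intro: rtrancl_into_rtrancl)
      then show "b \<in> {u. (n, u) \<in> ?R\<^sup>* \<and> u \<noteq> k}" using \<open>b \<noteq> k\<close> by simp
    qed
    then show False by simp
  qed
  then obtain u where u: "{u, k} \<in> E" "(n, u) \<in> ?R\<^sup>*" by blast
  have "(n, y) \<in> (adj (E - {{k, u}}))\<^sup>* \<and> y \<noteq> k" if "(n, y) \<in> ?R\<^sup>*" for y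
    using that
  proof (induction rule: rtrancl_induct)
    case base
    then show ?case using k by simp
  next
    case (step y z)
    then have "(y, z) \<in> adj (E - {{k, u}})" by (auto simp: doubleton_eq_iff)
    with step show ?case by (metis (mono_tags, lifting) case_prodD mem_Collect_eq rtrancl.rtrancl_into_rtrancl)
  qed
  then have "(n, u) \<in> (adj (E - {{k, u}}))\<^sup>*" using u by blast
  then have "n \<in> comp k u" by (simp add: comp_def adj_rtrancl_sym)
  then show "{parent n E k, k} \<in> E" "n \<in> comp k (parent n E k)"
    using parentI[OF u(1)] u(1) by auto
qed

text \<open>The subtree hanging at \<open>k\<close>, including \<open>k\<close>. Meaningful for
  \<open>k < n\<close>, as \<open>n\<close> has no parent.\<close>

definition desc :: "nat \<Rightarrow> nat set" where
  "desc k = comp (parent n E k) k"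

lemma desc_self: "k \<in> desc k"
  by (simp add: desc_def comp_self)

lemma parent_notin_desc: "k \<in> {1..<n} \<Longrightarrow> parent n E k \<notin> desc k"
  using parent_edge(1) comp_other by (simp add: desc_def)

lemma root_notin_desc:
  assumes "k \<in> {1..<n}"
  shows "n \<notin> desc k"
proof
  assume "n \<in> desc k"
  then have "(parent n E k, k) \<in> (adj (E - {{parent n E k, k}}))\<^sup>*"
    using parent_edge(2)[OF assms] unfolding desc_def comp_def
    unfolding insert_commute[of k "parent n E k" "{}"] mem_Collect_eq
    by (metis adj_rtrancl_sym rtrancl_trans)
  then show False using bridge parent_edge(1)[OF assms] by blast
qed

lemma desc_exit:
  "\<lbrakk>k \<in> {1..<n}; {x, y} \<in> E; x \<in> desc k; y \<notin> desc k\<rbrakk> \<Longrightarrow> x = k \<and> y = parent n E k"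
  unfolding desc_def by (rule comp_exit[OF parent_edge(1)])

text \<open>As a set of ordered pairs, \<open>adj E\<close> doubles as the set of darts, two per
  edge; this is where the length \<open>2 * n - 2\<close> of a tour comes from.\<close>

lemma card_adj: "card (adj E) = 2 * n - 2" and finite_adj: "finite (adj E)"
proof -
  have eq: "adj E = (\<Union>e\<in>E. {(u, v). {u, v} = e})" unfolding adj_def by blast
  have two: "card {(u, v). {u, v} = e} = 2 \<and> finite {(u, v). {u, v} = e}" if "e \<in> E" for e
  proof -
    have "\<exists>a b. e = {a, b} \<and> a \<noteq> b" using tree that unfolding is_tree_def by metis
    then obtain a b where ab: "e = {a, b}" "a \<noteq> b" by blast
    then have "{(u, v). {u, v} = e} = {(a, b), (b, a)}"
      unfolding ab doubleton_eq_iff by blast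
    then show ?thesis using ab by simp
  qed
  have "card (adj E) = (\<Sum>e\<in>E. card {(u, v). {u, v} = e})"
    unfolding eq by (intro card_UN_disjoint finite_E) (use two in blast)+
  then show "card (adj E) = 2 * n - 2" using two card_E by simp
  show "finite (adj E)" unfolding eq using finite_E two by blast
qed

lemma finite_nbrs: "finite (nbrs E v)"
proof -
  have "nbrs E v \<subseteq> {1..n}" using edgeD(2) by (auto simp: nbrs_def)
  then show ?thesis using finite_subset by blast
qed

lemma nbrs_nonempty:
  assumes "v \<in> {1..n}"
  shows "nbrs E v \<noteq> {}"
proof -
  define u where "u = (if v = 1 then n else 1)"
  have "(u, v) \<in> (adj E)\<^sup>*" "u \<noteq> v" using assms n_ge connected[of u v]
    by (auto simp: u_def)
  then obtain x where "(x, v) \<in> adj E" by (metis rtranclE)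
  then show ?thesis by (auto simp: nbrs_def)
qed

end

text \<open>Only the values of \<open>w\<close> up to time \<open>2 * n - 2\<close> are constrained,
  so a periodic walk such as \<open>cw_walk\<close> can be an instance.\<close>

locale tour = labeled_tree +
  fixes w :: "nat \<Rightarrow> nat"
  assumes start: "w 0 = n" and finish: "w (2 * n - 2) = n"
    and bij_darts: "bij_betw (\<lambda>t. (w t, w (Suc t))) {..<2 * n - 2} (adj E)"
begin

lemma edge: "t < 2 * n - 2 \<Longrightarrow> {w t, w (Suc t)} \<in> E"
  using bij_betwE[OF bij_darts] by auto

lemma dart_inj:
  "\<lbrakk>s < 2 * n - 2; t < 2 * n - 2; w s = w t; w (Suc s) = w (Suc t)\<rbrakk> \<Longrightarrow> s = t"
  using bij_betw_imp_inj_on[OF bij_darts] by (auto simp: inj_on_def)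

lemma dart_obtain:
  assumes "{u, v} \<in> E"
  obtains t where "t < 2 * n - 2" "w t = u" "w (Suc t) = v"
proof -
  have "(u, v) \<in> (\<lambda>t. (w t, w (Suc t))) ` {..<2 * n - 2}"
    using bij_betw_imp_surj_on[OF bij_darts] assms by simp
  then show ?thesis using that by auto
qed

lemma w_range:
  assumes "t \<le> 2 * n - 2"
  shows "w t \<in> {1..n}"
proof (cases "t = 2 * n - 2")
  case True
  then show ?thesis using finish n_ge by simp
next
  case False
  then show ?thesis using assms edgeD(2)[OF edge[of t]] by simp
qed

text \<open>A subtree is left only towards its parent, so a tour visits it during one time interval.\<close>

lemma desc_interval:
  assumes k: "k \<in> {1..<n}"
  obtains s e where "s < e" "e < 2 * n - 2" "w s = parent n E k" "w (Suc s) = k"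
    "w e = k" "w (Suc e) = parent n E k"
    "\<And>t. t \<le> 2 * n - 2 \<Longrightarrow> w t \<in> desc k \<longleftrightarrow> s < t \<and> t \<le> e"
proof -
  let ?p = "parent n E k"
  have pk: "{?p, k} \<in> E" "{k, ?p} \<in> E" using parent_edge(1)[OF k] by (auto simp: insert_commute)
  obtain s where s: "s < 2 * n - 2" "w s = ?p" "w (Suc s) = k" using dart_obtain[OF pk(1)] .
  obtain e where e: "e < 2 * n - 2" "w e = k" "w (Suc e) = ?p" using dart_obtain[OF pk(2)] .
  have out: "t = e" if "t < 2 * n - 2" "w t \<in> desc k" "w (Suc t) \<notin> desc k" for t
  proof -
    have "w t = k \<and> w (Suc t) = ?p" by (rule desc_exit[OF k edge[OF that(1)] that(2,3)])
    then show ?thesis using dart_inj[OF that(1) e(1)] e by simp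
  qed
  have inn: "t = s" if "t < 2 * n - 2" "w t \<notin> desc k" "w (Suc t) \<in> desc k" for t
  proof -
    have "{w (Suc t), w t} \<in> E" using edge[OF that(1)] by (simp add: insert_commute)
    then have "w (Suc t) = k \<and> w t = ?p" by (rule desc_exit[OF k _ that(3,2)])
    then show ?thesis using dart_inj[OF that(1) s(1)] s by simp
  qed
  have enter: "i \<le> s \<and> s < j" if ij: "w i \<notin> desc k" "w j \<in> desc k" "i \<le> j" "j \<le> 2 * n - 2" for i j
  proof -
    obtain t where "i \<le> t" "t < j" "w t \<notin> desc k" "w (Suc t) \<in> desc k"
      using exit_step[of "\<lambda>x. x \<notin> desc k" w i j] ij by auto
    then show ?thesis using inn[of t] ij by auto
  qed
  have leave: "i \<le> e \<and> e < j" if ij: "w i \<in> desc k" "w j \<notin> desc k" "i \<le> j" "j \<le> 2 * n - 2" for i j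
  proof -
    obtain t where "i \<le> t" "t < j" "w t \<in> desc k" "w (Suc t) \<notin> desc k"
      using exit_step[of "\<lambda>x. x \<in> desc k" w i j] ij by auto
    then show ?thesis using out[of t] ij by auto
  qed
  have w0: "w 0 \<notin> desc k" using start root_notin_desc[OF k] by simp
  have "s < e" using enter[of 0 e] w0 e desc_self by simp
  moreover have "w t \<in> desc k \<longleftrightarrow> s < t \<and> t \<le> e" if t: "t \<le> 2 * n - 2" for t
  proof
    assume td: "w t \<in> desc k"
    then have "s < t" using enter[of 0 t] w0 t by simp
    moreover have "t \<le> e"
    proof (rule ccontr)
      assume "\<not> t \<le> e"
      then have "Suc e \<le> s" using enter[of "Suc e" t] td t e parent_notin_desc[OF k] by simp
      then show False using \<open>s < e\<close> by simp
    qed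
    ultimately show "s < t \<and> t \<le> e" by simp
  next
    assume st: "s < t \<and> t \<le> e"
    show "w t \<in> desc k"
      using leave[of "Suc s" t] st t s desc_self by fastforce
  qed
  ultimately show ?thesis using that s e by blast
qed

end

section \<open>Cyclic successors\<close>

definition csucc :: "'a::linorder set \<Rightarrow> 'a \<Rightarrow> 'a" where
  "csucc X x = (if \<exists>y\<in>X. x < y then Min {y \<in> X. x < y} else Min X)"

text \<open>Reduces \<open>csucc\<close> to adding one to an index modulo \<open>card X\<close>; the
  facts on cyclic order below are then modular arithmetic.\<close>

lemma csucc_nth_sorted_list:
  assumes "finite X" "i < card X"
  shows "csucc X (sorted_list_of_set X ! i) = sorted_list_of_set X ! (Suc i mod card X)"
proof -
  define ys where "ys = sorted_list_of_set X"
  have len: "length ys = card X" and set: "set ys = X" and sorted: "sorted_wrt (<) ys"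
    using assms(1) by (simp_all add: ys_def)
  have less_iff: "ys ! a < ys ! b \<longleftrightarrow> a < b" if "a < card X" "b < card X" for a b
    using that sorted_wrt_nth_less[OF sorted] len by (metis linorder_neqE_nat order_less_asym order_less_irrefl)
  have mem: "y \<in> X \<longleftrightarrow> (\<exists>j<card X. y = ys ! j)" for y
    using set len by (metis in_set_conv_nth)
  have le_iff: "ys ! a \<le> ys ! b \<longleftrightarrow> a \<le> b" if "a < card X" "b < card X" for a b
    using less_iff[OF that(2,1)] by (simp add: not_less[symmetric])
  show ?thesis
  proof (cases "Suc i < card X")
    case True
    have "Min {y \<in> X. ys ! i < y} = ys ! Suc i"
    proof (rule Min_eqI)
      show "finite {y \<in> X. ys ! i < y}" using assms(1) by simp
      show "ys ! Suc i \<in> {y \<in> X. ys ! i < y}" using True less_iff mem by auto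
      fix y assume "y \<in> {y \<in> X. ys ! i < y}"
      then obtain j where "j < card X" "y = ys ! j" "ys ! i < ys ! j" using mem by auto
      then show "ys ! Suc i \<le> y" using less_iff[of i j] le_iff[of "Suc i" j] True assms(2) by simp
    qed
    moreover have "\<exists>y\<in>X. ys ! i < y" using True less_iff[of i "Suc i"] mem by auto
    ultimately show ?thesis using True by (simp add: csucc_def ys_def)
  next
    case False
    then have i: "Suc i = card X" using assms(2) by simp
    have "Min X = ys ! 0"
    proof (rule Min_eqI)
      show "ys ! 0 \<in> X" using mem assms(2) by (metis gr_implies_not_zero neq0_conv)
      fix y assume "y \<in> X"
      then obtain j where "j < card X" "y = ys ! j" using mem by auto
      then show "ys ! 0 \<le> y" using le_iff[of 0 j] assms(2) by simp
    qed (fact assms(1))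
    moreover have "\<not> (\<exists>y\<in>X. ys ! i < y)"
    proof
      assume "\<exists>y\<in>X. ys ! i < y"
      then obtain j where "j < card X" "ys ! i < ys ! j" using mem by auto
      then show False using less_iff[of i j] assms(2) i by simp
    qed
    ultimately show ?thesis using i by (simp add: csucc_def ys_def)
  qed
qed

lemma sorted_list_nth_obtain:
  assumes "finite X" "x \<in> X"
  obtains i where "i < card X" "x = sorted_list_of_set X ! i"
  using assms by (metis in_set_conv_nth length_sorted_list_of_set set_sorted_list_of_set)

lemma inj_on_csucc:
  assumes "finite X"
  shows "inj_on (csucc X) X"
proof (rule inj_onI)
  fix x y assume xy: "x \<in> X" "y \<in> X" "csucc X x = csucc X y"
  obtain i where i: "i < card X" "x = sorted_list_of_set X ! i"
    using sorted_list_nth_obtain[OF assms xy(1)] .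
  obtain j where j: "j < card X" "y = sorted_list_of_set X ! j"
    using sorted_list_nth_obtain[OF assms xy(2)] .
  have "Suc i mod card X < card X" "Suc j mod card X < card X" using i by simp_all
  then have "Suc i mod card X = Suc j mod card X"
    using xy(3) csucc_nth_sorted_list[OF assms i(1)] csucc_nth_sorted_list[OF assms j(1)] i(2) j(2)
      nth_eq_iff_index_eq[OF distinct_sorted_list_of_set, of "Suc i mod card X" X "Suc j mod card X"]
    by simp
  then have "i = j" using i(1) j(1) by (auto simp: mod_Suc split: if_splits)
  then show "x = y" using i j by simp
qed

text \<open>The entry at \<open>i\<close> has index \<open>q + i\<close> modulo
  \<open>card X\<close> in the sorted list. This leads from clockwise turning to sortedness;
  \<open>csucc_sorted_rotate\<close> leads back.\<close>

lemma csucc_iterates_rotate: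
  assumes "finite X" "length zs = card X" "zs ! 0 \<in> X"
    and "\<And>i. Suc i < card X \<Longrightarrow> zs ! Suc i = csucc X (zs ! i)"
  obtains q where "q < card X" "zs = rotate q (sorted_list_of_set X)"
    "zs ! 0 = sorted_list_of_set X ! q"
proof -
  obtain q where q: "q < card X" "zs ! 0 = sorted_list_of_set X ! q"
    using sorted_list_nth_obtain[OF assms(1,3)] .
  have nth: "zs ! i = sorted_list_of_set X ! ((q + i) mod card X)" if "i < card X" for i
    using that
  proof (induction i)
    case 0
    then show ?case using q by simp
  next
    case (Suc i)
    then have "zs ! Suc i = csucc X (sorted_list_of_set X ! ((q + i) mod card X))"
      using assms(4)[of i] by simp
    also have "\<dots> = sorted_list_of_set X ! (Suc ((q + i) mod card X) mod card X)"
      using q(1) by (intro csucc_nth_sorted_list assms(1)) simp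
    finally show ?case by (simp add: mod_Suc_eq)
  qed
  have "zs = rotate q (sorted_list_of_set X)"
  proof (rule nth_equalityI)
    show "length zs = length (rotate q (sorted_list_of_set X))" using assms(2) by simp
    show "zs ! i = rotate q (sorted_list_of_set X) ! i" if "i < length zs" for i
      using that nth[of i] assms(2) by (simp add: nth_rotate)
  qed
  then show ?thesis using that q by blast
qed

lemma rotate_rotate_back:
  assumes "xs \<noteq> []"
  obtains r where "xs = rotate r (rotate q xs)"
proof
  let ?l = "length xs"
  \<comment> \<open>The witness is \<open>?l * q - q\<close>: both rotations together turn by a
    multiple of the length. The inequality keeps the natural subtraction from truncating.\<close>
  have "q \<le> ?l * q" using assms by (cases ?l) auto
  then have "(?l * q - q + q) mod ?l = 0" by simp
  then show "xs = rotate (?l * q - q) (rotate q xs)"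
    by (simp only: rotate_rotate rotate_id)
qed

lemma csucc_sorted_rotate:
  assumes "sorted_wrt (<) (rotate q zs)" "i < length zs"
  shows "csucc (set zs) (zs ! i) = zs ! (Suc i mod length zs)"
proof -
  let ?l = "length zs"
  have "zs \<noteq> []" using assms(2) by auto
  then obtain r where r: "zs = rotate r (rotate q zs)" using rotate_rotate_back by blast
  have ys: "rotate q zs = sorted_list_of_set (set zs)"
    using assms(1) strict_sorted_equal by (metis List.finite_set set_rotate
        set_sorted_list_of_set strict_sorted_list_of_set)
  have l: "?l = card (set zs)" using ys by (metis length_rotate length_sorted_list_of_set)
  have nth: "zs ! j = sorted_list_of_set (set zs) ! ((r + j) mod ?l)" if "j < ?l" for j
  proof -
    have "rotate r (rotate q zs) ! j = rotate q zs ! ((r + j) mod ?l)"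
      using that by (simp only: nth_rotate length_rotate)
    then show ?thesis unfolding r[symmetric] unfolding ys .
  qed
  have "csucc (set zs) (zs ! i) = sorted_list_of_set (set zs) ! (Suc ((r + i) mod ?l) mod ?l)"
    unfolding nth[OF assms(2)] using \<open>zs \<noteq> []\<close> by (subst csucc_nth_sorted_list) (auto simp: l[symmetric])
  also have "\<dots> = zs ! (Suc i mod ?l)"
  proof (subst nth)
    show "Suc i mod ?l < ?l" using \<open>zs \<noteq> []\<close> by simp
    have "Suc ((r + i) mod ?l) mod ?l = (r + Suc i mod ?l) mod ?l"
      by (simp add: mod_simps)
    then show "sorted_list_of_set (set zs) ! (Suc ((r + i) mod ?l) mod ?l) =
      sorted_list_of_set (set zs) ! ((r + Suc i mod ?l) mod ?l)" by simp
  qed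
  finally show ?thesis .
qed

text \<open>\<open>csucc X\<close> is a single cycle on \<open>X\<close>, so iterating it from any
  point of \<open>Y\<close> runs through all of \<open>X\<close>.\<close>

lemma csucc_closed_eq:
  assumes "finite X" "Y \<subseteq> X" "Y \<noteq> {}" "\<And>y. y \<in> Y \<Longrightarrow> csucc X y \<in> Y"
  shows "Y = X"
proof -
  let ?ys = "sorted_list_of_set X"
  obtain y where y: "y \<in> Y" using assms(3) by blast
  then obtain q where q: "q < card X" "y = ?ys ! q"
    using sorted_list_nth_obtain[OF assms(1)] assms(2) by blast
  have iter: "?ys ! ((q + i) mod card X) \<in> Y" for i
  proof (induction i)
    case 0
    then show ?case using q y by simp
  next
    case (Suc i)
    have "csucc X (?ys ! ((q + i) mod card X)) = ?ys ! (Suc ((q + i) mod card X) mod card X)"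
      using q(1) by (intro csucc_nth_sorted_list assms(1)) simp
    then show ?case using assms(4)[OF Suc] by (simp add: mod_Suc_eq)
  qed
  have "x \<in> Y" if x: "x \<in> X" for x
  proof -
    obtain j where j: "j < card X" "x = ?ys ! j" using sorted_list_nth_obtain[OF assms(1) x] .
    have "(q + (card X - q + j)) mod card X = j" using q(1) j(1) by simp
    then show ?thesis using iter[of "card X - q + j"] j(2) by simp
  qed
  then show ?thesis using assms(2) by blast
qed

text \<open>The last entry of \<open>cs\<close>, which will be the parent, does not occur in the
  chain of inequalities; \<open>k\<close> takes its place. The chain for \<open>j\<close> is the
  rotation by \<open>j\<close> of \<open>k\<close> followed by the other entries.\<close>

lemma cyc_cond_iff_rotate:
  "cyc_cond cs k \<longleftrightarrow> cs \<noteq> [] \<and> (\<exists>q. sorted_wrt (<) (rotate q (k # butlast cs)))"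
proof
  assume "cyc_cond cs k"
  then obtain j where j: "1 \<le> j" "j \<le> length cs"
    "sorted_wrt (<) (drop (j - 1) (take (length cs - 1) cs) @ [k] @ take (j - 1) cs)"
    unfolding cyc_cond_def by blast
  have cs: "cs \<noteq> []" using j by auto
  have "rotate j (k # butlast cs) = drop (j - 1) (take (length cs - 1) cs) @ [k] @ take (j - 1) cs"
  proof (cases "j = length cs")
    case True
    then show ?thesis using cs j(1) by (simp add: rotate_drop_take butlast_conv_take)
  next
    case False
    then have "j < length cs" using j by simp
    then show ?thesis using j(1)
      by (cases j) (simp_all add: rotate_drop_take butlast_conv_take)
  qed
  then show "cs \<noteq> [] \<and> (\<exists>q. sorted_wrt (<) (rotate q (k # butlast cs)))"
    using j(3) cs by metis
next
  assume "cs \<noteq> [] \<and> (\<exists>q. sorted_wrt (<) (rotate q (k # butlast cs)))"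
  then obtain q where cs: "cs \<noteq> []" and q: "sorted_wrt (<) (rotate q (k # butlast cs))" by blast
  let ?q = "q mod length cs"
  have rot: "rotate q (k # butlast cs) = drop ?q (k # butlast cs) @ take ?q (k # butlast cs)"
    using cs by (simp add: rotate_drop_take)
  have "?q < length cs" using cs by simp
  \<comment> \<open>Since \<open>j\<close> starts at 1, the trivial rotation is represented by a
    full turn \<open>j = length cs\<close>, for which the part before \<open>k\<close> is
    empty.\<close>
  define j where "j = (if ?q = 0 then length cs else ?q)"
  have "sorted_wrt (<) (drop (j - 1) (take (length cs - 1) cs) @ [k] @ take (j - 1) cs)"
  proof (cases "?q = 0")
    case True
    then show ?thesis using q unfolding rot j_def by (simp add: butlast_conv_take)
  next
    case False
    then obtain r where r: "?q = Suc r" using not0_implies_Suc by blast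
    then show ?thesis using q \<open>?q < length cs\<close> unfolding rot j_def
      by (simp add: butlast_conv_take)
  qed
  moreover have "1 \<le> j" "j \<le> length cs" using cs \<open>?q < length cs\<close> by (auto simp: j_def Suc_le_eq)
  ultimately show "cyc_cond cs k" unfolding cyc_cond_def by blast
qed

lemma the_arg_min:
  fixes f :: "'a \<Rightarrow> 'b::linorder"
  assumes "finite A" "A \<noteq> {}" "inj_on f A"
  shows "(THE x. x \<in> A \<and> (\<forall>y\<in>A. f x \<le> f y)) \<in> A"
    and "f (THE x. x \<in> A \<and> (\<forall>y\<in>A. f x \<le> f y)) = Min (f ` A)"
proof -
  have "Min (f ` A) \<in> f ` A" using assms by (intro Min_in) auto
  then obtain a where a: "a \<in> A" "f a = Min (f ` A)" by auto
  have "(THE x. x \<in> A \<and> (\<forall>y\<in>A. f x \<le> f y)) = a"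
  proof (rule the_equality)
    show "a \<in> A \<and> (\<forall>y\<in>A. f a \<le> f y)" using a assms(1) by simp
    show "x = a" if "x \<in> A \<and> (\<forall>y\<in>A. f x \<le> f y)" for x
      using that a assms(1,3) by (metis Min_le antisym finite_imageI imageI inj_onD)
  qed
  then show "(THE x. x \<in> A \<and> (\<forall>y\<in>A. f x \<le> f y)) \<in> A"
    "f (THE x. x \<in> A \<and> (\<forall>y\<in>A. f x \<le> f y)) = Min (f ` A)" using a by simp_all
qed

section \<open>Rotation around a vertex as cyclic successor of values\<close>

context labeled_tree
begin

abbreviation nvals :: "nat \<Rightarrow> nat set" where
  "nvals v \<equiv> nval n E v ` nbrs E v"

lemma nbrs_edge: "u \<in> nbrs E v \<longleftrightarrow> {u, v} \<in> E"
  by (simp add: nbrs_def)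

text \<open>The value \<open>v\<close> given to the parent clashes with no label, since
  \<open>v\<close> is not its own neighbour.\<close>

lemma inj_on_nval: "inj_on (nval n E v) (nbrs E v)"
proof (rule inj_onI)
  fix x y assume "x \<in> nbrs E v" "y \<in> nbrs E v" "nval n E v x = nval n E v y"
  moreover from this have "x \<noteq> v" "y \<noteq> v" using edgeD(1) by (auto simp: nbrs_edge)
  ultimately show "x = y" by (auto simp: nval_def split: if_splits)
qed

lemma finite_nvals: "finite (nvals v)"
  using finite_nbrs by simp

text \<open>Both branches of the definition pick the neighbour of least value, among the larger
  values or among all. Injectivity of the values makes this choice unique, and \<open>nval\<close>
  then carries \<open>cw_next\<close> to \<open>csucc\<close>.\<close>

lemma cw_next:
  assumes u: "u \<in> nbrs E v"
  shows "cw_next n E v u \<in> nbrs E v" "nval n E v (cw_next n E v u) = csucc (nvals v) (nval n E v u)"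
proof -
  let ?f = "nval n E v"
  let ?A = "{x \<in> nbrs E v. ?f u < ?f x}"
  have "cw_next n E v u \<in> nbrs E v \<and> ?f (cw_next n E v u) = csucc (nvals v) (?f u)"
  proof (cases "\<exists>x\<in>nbrs E v. ?f x > ?f u")
    case True
    have eq: "cw_next n E v u = (THE x. x \<in> ?A \<and> (\<forall>y\<in>?A. ?f x \<le> ?f y))"
      using True unfolding cw_next_def by (simp add: conj_assoc Ball_def imp_conjL)
    have A: "finite ?A" "?A \<noteq> {}" "inj_on ?f ?A"
      using finite_nbrs True inj_on_nval inj_on_subset by (auto simp: inj_on_def)
    have "?f ` ?A = {y \<in> nvals v. ?f u < y}" by auto
    then show ?thesis using the_arg_min[OF A] True unfolding eq csucc_def by auto
  next
    case False
    then have eq: "cw_next n E v u = (THE x. x \<in> nbrs E v \<and> (\<forall>y\<in>nbrs E v. ?f x \<le> ?f y))"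
      unfolding cw_next_def by simp
    have "nbrs E v \<noteq> {}" using u by auto
    then show ?thesis using the_arg_min[OF finite_nbrs _ inj_on_nval] False
      unfolding eq csucc_def by auto
  qed
  then show "cw_next n E v u \<in> nbrs E v" "?f (cw_next n E v u) = csucc (nvals v) (?f u)" by auto
qed

lemma cw_nextI:
  assumes "u \<in> nbrs E v" "x \<in> nbrs E v" "nval n E v x = csucc (nvals v) (nval n E v u)"
  shows "cw_next n E v u = x"
  using cw_next[OF assms(1)] assms(2,3) inj_on_nval by (metis inj_onD)

lemma inj_on_cw_next: "inj_on (cw_next n E v) (nbrs E v)"
proof (rule inj_onI)
  fix x y assume x: "x \<in> nbrs E v" and y: "y \<in> nbrs E v" and "cw_next n E v x = cw_next n E v y"
  then have "csucc (nvals v) (nval n E v x) = csucc (nvals v) (nval n E v y)"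
    using cw_next(2) by metis
  then have "nval n E v x = nval n E v y"
    using inj_onD[OF inj_on_csucc[OF finite_nvals]] x y by blast
  then show "x = y" using inj_onD[OF inj_on_nval] x y by blast
qed

lemma cw_next_closed_eq:
  assumes "Y \<subseteq> nbrs E v" "Y \<noteq> {}" "\<And>y. y \<in> Y \<Longrightarrow> cw_next n E v y \<in> Y"
  shows "Y = nbrs E v"
proof -
  have "nval n E v ` Y = nvals v"
  proof (rule csucc_closed_eq[OF finite_nvals])
    fix z assume "z \<in> nval n E v ` Y"
    then obtain y where y: "y \<in> Y" "z = nval n E v y" by blast
    then show "csucc (nvals v) z \<in> nval n E v ` Y"
      using cw_next(2)[of y v] assms(1,3) by (metis image_eqI subsetD)
  qed (use assms in auto)
  then show ?thesis using inj_on_nval assms(1) by (meson inj_on_image_eq_iff order_refl)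
qed

end

section \<open>Departures of an Euler tour\<close>

lemma sorted_wrt_less_nth_next:
  fixes ts :: "'a::linorder list"
  assumes "sorted_wrt (<) ts" "t \<in> set ts" "i < length ts" "ts ! i < t"
  shows "Suc i < length ts" "ts ! Suc i \<le> t"
proof -
  obtain j where j: "j < length ts" "t = ts ! j" using assms(2) by (metis in_set_conv_nth)
  have "i < j"
  proof (rule ccontr)
    assume "\<not> i < j"
    then have "j < i \<or> j = i" by auto
    then show False using sorted_wrt_nth_less[OF assms(1), of j i] assms(3,4) j by auto
  qed
  then show "Suc i < length ts" using j by simp
  show "ts ! Suc i \<le> t"
    using j \<open>i < j\<close> sorted_wrt_nth_less[OF assms(1), of "Suc i" j] by (cases "Suc i = j") auto
qed

lemma sorted_wrt_less_nth_0:
  fixes ts :: "'a::linorder list"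
  assumes "sorted_wrt (<) ts" "t \<in> set ts"
  shows "ts ! 0 \<le> t"
proof -
  obtain j where j: "j < length ts" "t = ts ! j" using assms(2) by (metis in_set_conv_nth)
  then show ?thesis using sorted_wrt_nth_less[OF assms(1), of 0 j] by (cases "j = 0") auto
qed

context tour
begin

definition times :: "nat \<Rightarrow> nat list" where
  "times v = filter (\<lambda>t. w t = v) [0..<2 * n - 2]"

text \<open>This is N_r(v) read off the tour, as \<open>Nlist_outs\<close> confirms. The times stop
  before \<open>2 * n - 2\<close> because the final arrival at \<open>n\<close> is followed by no
  departure.\<close>

definition outs :: "nat \<Rightarrow> nat list" where
  "outs v = map (\<lambda>t. w (Suc t)) (times v)"

text \<open>The parent is the last departure, but it is moved to the front because its value v is the one
  that the cyclicity condition puts next to c_1.\<close>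

definition rots :: "nat \<Rightarrow> nat list" where
  "rots v = (if v = n then outs v else last (outs v) # butlast (outs v))"

lemma set_times: "t \<in> set (times v) \<longleftrightarrow> t < 2 * n - 2 \<and> w t = v"
  by (auto simp: times_def)

lemma sorted_times: "sorted_wrt (<) (times v)"
  by (simp add: times_def sorted_wrt_filter)

lemma length_outs: "length (outs v) = length (times v)"
  by (simp add: outs_def)

lemma times_nth: "i < length (outs v) \<Longrightarrow> times v ! i < 2 * n - 2 \<and> w (times v ! i) = v"
  using set_times[of "times v ! i" v] by (simp add: length_outs)

lemma outs_nth: "i < length (outs v) \<Longrightarrow> outs v ! i = w (Suc (times v ! i))"
  by (simp add: outs_def)

lemma distinct_outs: "distinct (outs v)"
  unfolding outs_def distinct_map
proof
  show "distinct (times v)" by (simp add: times_def)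
  show "inj_on (\<lambda>t. w (Suc t)) (set (times v))"
    by (rule inj_onI) (auto simp: set_times intro: dart_inj)
qed

lemma set_outs: "set (outs v) = nbrs E v"
proof
  show "set (outs v) \<subseteq> nbrs E v"
  proof
    fix u assume "u \<in> set (outs v)"
    then obtain t where "t < 2 * n - 2" "w t = v" "u = w (Suc t)"
      by (auto simp: outs_def set_times)
    then show "u \<in> nbrs E v" using edge[of t] by (simp add: nbrs_edge insert_commute)
  qed
  show "nbrs E v \<subseteq> set (outs v)"
  proof
    fix u assume "u \<in> nbrs E v"
    then have "{v, u} \<in> E" by (simp add: nbrs_edge insert_commute)
    then obtain t where "t < 2 * n - 2" "w t = v" "w (Suc t) = u" by (rule dart_obtain)
    then show "u \<in> set (outs v)" by (force simp: outs_def set_times)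
  qed
qed

lemma outs_nonempty: "v \<in> {1..n} \<Longrightarrow> outs v \<noteq> []"
  using nbrs_nonempty set_outs by (metis list.set(1))

lemma outs_edge: "i < length (outs v) \<Longrightarrow> {v, outs v ! i} \<in> E"
  using set_outs[of v] nth_mem[of i "outs v"] by (simp add: nbrs_edge insert_commute)

text \<open>In a tree, a walk that leaves a vertex towards a child returns from that same child.\<close>

lemma outs_child:
  assumes i: "i < length (outs v)" and u: "outs v ! i \<noteq> n" "v = parent n E (outs v ! i)"
  obtains t where "times v ! i < t" "t < 2 * n - 2" "w t = outs v ! i" "w (Suc t) = v"
    "\<And>r. r < 2 * n - 2 \<Longrightarrow> w r = v \<Longrightarrow> times v ! i < r \<Longrightarrow> t < r"
proof -
  let ?u = "outs v ! i"
  have "?u \<in> {1..<n}" using edgeD(3)[OF outs_edge[OF i]] u by auto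
  then obtain s e where se: "s < e" "e < 2 * n - 2" "w s = v" "w (Suc s) = ?u"
    "w e = ?u" "w (Suc e) = v" "\<And>t. t \<le> 2 * n - 2 \<Longrightarrow> w t \<in> desc ?u \<longleftrightarrow> s < t \<and> t \<le> e"
    using desc_interval[of ?u] u(2) by metis
  have "v \<notin> desc ?u" using parent_notin_desc[of ?u] \<open>?u \<in> {1..<n}\<close> u(2) by simp
  have s: "s = times v ! i"
    using dart_inj[of s "times v ! i"] se(1-4) times_nth[OF i] outs_nth[OF i] by simp
  show ?thesis
  proof (rule that[of e])
    show "e < r" if "r < 2 * n - 2" "w r = v" "times v ! i < r" for r
      using se(7)[of r] that \<open>v \<notin> desc ?u\<close> s by auto
  qed (use se s in auto)
qed

text \<open>Leaving towards the parent ends the one time interval spent in the subtree of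
  \<open>v\<close>, so \<open>v\<close> is never visited again.\<close>

lemma outs_parent:
  assumes i: "i < length (outs v)" and v: "v \<noteq> n" "outs v ! i = parent n E v"
  shows "Suc i = length (outs v)"
proof (rule ccontr)
  assume "Suc i \<noteq> length (outs v)"
  then have i': "Suc i < length (outs v)" using i by simp
  have "v \<in> {1..<n}" using edgeD(2)[OF outs_edge[OF i]] v by auto
  then obtain s e where se: "e < 2 * n - 2" "w e = v" "w (Suc e) = outs v ! i"
    "\<And>t. t \<le> 2 * n - 2 \<Longrightarrow> w t \<in> desc v \<longleftrightarrow> s < t \<and> t \<le> e"
    using desc_interval[of v] v(2) by metis
  have "e = times v ! i"
    using dart_inj[of e "times v ! i"] se(1-3) times_nth[OF i] outs_nth[OF i] by simp
  moreover have "times v ! i < times v ! Suc i"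
    using i' sorted_times by (intro sorted_wrt_nth_less) (auto simp: length_outs)
  ultimately show False
    using se(4)[of "times v ! Suc i"] times_nth[OF i'] desc_self by simp
qed

lemma last_outs:
  assumes "v \<in> {1..<n}"
  shows "last (outs v) = parent n E v"
proof -
  have "parent n E v \<in> set (outs v)" using parent_edge(1)[OF assms] by (simp add: set_outs nbrs_edge)
  then obtain i where i: "i < length (outs v)" "outs v ! i = parent n E v"
    by (auto simp: in_set_conv_nth)
  then have "i = length (outs v) - 1" using outs_parent[OF i(1)] assms by simp
  then show ?thesis using i by (metis last_conv_nth list.size(3) not_less_zero)
qed

text \<open>Turns the order of departures into a local turning rule. If \<open>outs v ! i\<close> is
  a child, the next visit to \<open>v\<close> is the return from that child, hence the next
  departure happens there; if it is the parent, no departure follows.\<close>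

lemma outs_next:
  assumes i: "Suc i < length (outs v)"
  obtains t where "Suc t < 2 * n - 2" "w t = outs v ! i" "w (Suc t) = v"
    "w (Suc (Suc t)) = outs v ! Suc i"
proof -
  have i0: "i < length (outs v)" using i by simp
  from outs_edge[OF i0] show ?thesis
  proof (cases rule: edge_cases)
    case 1
    then obtain t where t: "times v ! i < t" "t < 2 * n - 2" "w t = outs v ! i" "w (Suc t) = v"
      "\<And>r. r < 2 * n - 2 \<Longrightarrow> w r = v \<Longrightarrow> times v ! i < r \<Longrightarrow> t < r"
      using outs_child[OF i0] by metis
    have lt: "times v ! i < times v ! Suc i"
      using i sorted_times by (intro sorted_wrt_nth_less) (auto simp: length_outs)
    have ge: "Suc t \<le> times v ! Suc i" using t(5)[of "times v ! Suc i"] times_nth[OF i] lt by simp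
    then have "Suc t < 2 * n - 2" using times_nth[OF i] by simp
    then have "Suc t \<in> set (times v)" using t by (simp add: set_times)
    then have "times v ! Suc i \<le> Suc t"
      using sorted_wrt_less_nth_next(2)[OF sorted_times, of "Suc t" v i] t(1) i0
      by (simp add: length_outs)
    then have "Suc t = times v ! Suc i" using ge by simp
    then show ?thesis using that[of t] t \<open>Suc t < 2 * n - 2\<close> outs_nth[OF i] by simp
  next
    case 2
    then show ?thesis using outs_parent[OF i0] i by simp
  qed
qed

text \<open>The subtree of \<open>v\<close> can be entered only from the parent, and the entry is
  itself the first visit to \<open>v\<close>.\<close>

lemma outs_first:
  assumes v: "v \<in> {1..<n}"
  obtains t where "Suc t < 2 * n - 2" "w t = parent n E v" "w (Suc t) = v"
    "w (Suc (Suc t)) = outs v ! 0"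
proof -
  obtain s e where se: "s < e" "e < 2 * n - 2" "w s = parent n E v" "w (Suc s) = v"
    "\<And>t. t \<le> 2 * n - 2 \<Longrightarrow> w t \<in> desc v \<longleftrightarrow> s < t \<and> t \<le> e"
    using desc_interval[OF v] by metis
  have l: "0 < length (outs v)" using outs_nonempty v by auto
  have "Suc s \<in> set (times v)" using se by (simp add: set_times)
  then have "times v ! 0 \<le> Suc s" using sorted_wrt_less_nth_0[OF sorted_times] by blast
  moreover have "s < times v ! 0" using se(5)[of "times v ! 0"] times_nth[OF l] desc_self by simp
  ultimately have "times v ! 0 = Suc s" by simp
  then show ?thesis using that[of s] se outs_nth[OF l] by simp
qed

lemma outs_after_arrival:
  assumes t: "Suc t < 2 * n - 2" and i: "i < length (outs (w (Suc t)))"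
    and wt: "w t = outs (w (Suc t)) ! i"
  shows "w (Suc (Suc t)) = outs (w (Suc t)) ! (Suc i mod length (outs (w (Suc t))))"
proof -
  define v where "v = w (Suc t)"
  have vr: "v \<in> {1..n}" using w_range t by (simp add: v_def)
  have i': "i < length (outs v)" and wt': "w t = outs v ! i" using i wt by (simp_all add: v_def)
  show ?thesis
    unfolding v_def[symmetric]
  proof (cases "Suc i < length (outs v)")
    case True
    then obtain t' where t': "Suc t' < 2 * n - 2" "w t' = outs v ! i" "w (Suc t') = v"
      "w (Suc (Suc t')) = outs v ! Suc i" by (rule outs_next)
    then have "t' = t" using dart_inj[of t' t] t wt' v_def by simp
    then show "w (Suc (Suc t)) = outs v ! (Suc i mod length (outs v))" using t'(4) True by simp
  next
    case False
    then have l: "Suc i = length (outs v)" using i' by simp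
    show "w (Suc (Suc t)) = outs v ! (Suc i mod length (outs v))"
    proof (cases "v = n")
      case True
      \<comment> \<open>At \<open>n\<close> the wrap-around does not occur before the end of the
        tour. All neighbours of \<open>n\<close> are children, so an arrival from the last one at a
        time before \<open>2 * n - 2\<close> would be followed by one more departure.\<close>
      from outs_edge[OF i'] have "outs v ! i \<noteq> n \<and> v = parent n E (outs v ! i)"
        using True by (cases rule: edge_cases) auto
      then obtain t' where t': "times v ! i < t'" "t' < 2 * n - 2" "w t' = outs v ! i" "w (Suc t') = v"
        using outs_child[OF i'] by metis
      then have "t' = t" using dart_inj[of t' t] t wt' v_def by simp
      moreover have "Suc t \<in> set (times v)" using t by (simp add: set_times v_def)
      ultimately have "Suc i < length (times v)"
        using sorted_wrt_less_nth_next(1)[OF sorted_times, of "Suc t" v i] t'(1) i'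
        by (simp add: length_outs)
      then show ?thesis using l by (simp add: length_outs)
    next
      case False
      \<comment> \<open>At other vertices the wrap-around is real: the last departure goes to the
        parent, and the arrival from the parent precedes the first departure.\<close>
      then have v: "v \<in> {1..<n}" using vr by auto
      have "last (outs v) = outs v ! i"
        using l outs_nonempty[OF vr] by (metis diff_Suc_1 last_conv_nth)
      then have "w t = parent n E v" using wt' last_outs[OF v] by simp
      moreover obtain t' where t': "Suc t' < 2 * n - 2" "w t' = parent n E v" "w (Suc t') = v"
        "w (Suc (Suc t')) = outs v ! 0" using outs_first[OF v] .
      ultimately have "t' = t" using dart_inj[of t' t] t v_def by simp
      then show ?thesis using t'(4) l by simp
    qed
  qed
qed

lemma length_rots: "v \<in> {1..n} \<Longrightarrow> length (rots v) = length (outs v)"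
  using outs_nonempty[of v] by (simp add: rots_def)

lemma set_rots:
  assumes "v \<in> {1..n}"
  shows "set (rots v) = nbrs E v"
proof -
  have "set (butlast (outs v) @ [last (outs v)]) = nbrs E v"
    using append_butlast_last_id[OF outs_nonempty[OF assms]] set_outs by metis
  then show ?thesis by (auto simp: rots_def set_outs)
qed

lemma rots_nth:
  assumes v: "v \<in> {1..<n}" and i: "i < length (outs v)"
  shows "rots v ! (Suc i mod length (outs v)) = outs v ! i"
proof (cases "Suc i < length (outs v)")
  case True
  then show ?thesis using v by (simp add: rots_def nth_butlast)
next
  case False
  then have "Suc i = length (outs v)" using i by simp
  moreover from this have "last (outs v) = outs v ! i"
    by (metis diff_Suc_1 last_conv_nth list.size(3) nat.distinct(1))
  ultimately show ?thesis using v by (simp add: rots_def)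
qed

lemma rots_next:
  assumes v: "v \<in> {1..n}" and i: "Suc i < length (rots v)"
  obtains t where "Suc t < 2 * n - 2" "w t = rots v ! i" "w (Suc t) = v"
    "w (Suc (Suc t)) = rots v ! Suc i"
proof (cases "v = n")
  case True
  then show ?thesis using outs_next[of i v] i that by (auto simp: rots_def)
next
  case False
  then have v': "v \<in> {1..<n}" using v by auto
  have i': "Suc i < length (outs v)" using i length_rots[OF v] by simp
  then have r: "rots v ! Suc i = outs v ! i" using rots_nth[OF v', of i] by simp
  show ?thesis
  proof (cases i)
    case 0
    then show ?thesis using outs_first[OF v'] that r last_outs[OF v'] False
      by (auto simp: rots_def)
  next
    case (Suc j)
    then have "rots v ! i = outs v ! j" using rots_nth[OF v', of j] i' by simp
    then show ?thesis using outs_next[of j v] that r i' Suc by auto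
  qed
qed

lemma rots_after_arrival:
  assumes t: "Suc t < 2 * n - 2" and v: "w (Suc t) = v"
  obtains i where "i < length (rots v)" "w t = rots v ! i"
    "w (Suc (Suc t)) = rots v ! (Suc i mod length (rots v))"
proof -
  have vr: "v \<in> {1..n}" using w_range[of "Suc t"] t v by simp
  have "w t \<in> set (outs v)" using edge[of t] t v by (simp add: set_outs nbrs_edge)
  then obtain j where j: "j < length (outs v)" "w t = outs v ! j" by (auto simp: in_set_conv_nth)
  have next': "w (Suc (Suc t)) = outs v ! (Suc j mod length (outs v))"
    using outs_after_arrival[OF t] j v by simp
  show ?thesis
  proof (cases "v = n")
    case True
    then show ?thesis using that[of j] j next' by (simp add: rots_def)
  next
    case False
    then have v': "v \<in> {1..<n}" using vr by auto
    let ?l = "length (outs v)"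
    have "Suc j mod ?l < ?l" using outs_nonempty[OF vr] by simp
    then show ?thesis
      using that[of "Suc j mod ?l"] rots_nth[OF v' j(1)] rots_nth[OF v', of "Suc j mod ?l"] j next'
        length_rots[OF vr] by simp
  qed
qed

end

section \<open>The clockwise walk\<close>

text \<open>Injectivity allows cancelling \<open>f\<close> along the orbit, so the first value to
  recur is \<open>c 0\<close> and the orbit has no preperiod. The least period \<open>p\<close> then
  separates the values on \<open>{..<p}\<close>.\<close>

lemma injective_orbit:
  fixes c :: "nat \<Rightarrow> 'a"
  assumes fin: "finite D" and mem: "\<And>t. c t \<in> D" and step: "\<And>t. c (Suc t) = f (c t)"
    and inj: "inj_on f D"
  obtains p where "0 < p" "\<And>t. c (t + p) = c t" "inj_on c {..<p}" "range c = c ` {..<p}"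
proof -
  have shift: "c (i + d) = c i \<Longrightarrow> c d = c 0" for i d
  proof (induction i)
    case (Suc i)
    then show ?case using inj_onD[OF inj _ mem mem, of "i + d" i] step by simp
  qed simp
  have "finite (range c)" using fin mem by (meson finite_subset image_subsetI)
  then have "\<not> inj c" using finite_imageD infinite_UNIV_nat by blast
  then obtain i j where ij: "i < j" "c i = c j"
    by (metis injI linorder_neqE_nat)
  have "c (j - i) = c 0" using shift[of i "j - i"] ij by simp
  then have ex: "\<exists>p. 0 < p \<and> c p = c 0" using ij(1) by (intro exI[of _ "j - i"]) simp
  define p where "p = (LEAST p. 0 < p \<and> c p = c 0)"
  have p: "0 < p" "c p = c 0" using LeastI_ex[OF ex] by (simp_all add: p_def)
  have min: "d = 0 \<or> p \<le> d" if "c d = c 0" for d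
    using that Least_le[of "\<lambda>p. 0 < p \<and> c p = c 0" d] by (auto simp: p_def)
  have per: "c (t + p) = c t" for t
    by (induction t) (use p step in auto)
  have per': "c (t mod p) = c t" for t
  proof -
    have "c (r + q * p) = c r" for q r
    proof (induction q)
      case (Suc q)
      then show ?case using per[of "r + q * p"] by (simp add: ac_simps)
    qed simp
    from this[of "t mod p" "t div p"] show ?thesis by (simp add: mod_div_mult_eq)
  qed
  show ?thesis
  proof (rule that[OF p(1) per])
    have "i = j" if "i \<le> j" "j < p" "c i = c j" for i j
      using shift[of i "j - i"] min[of "j - i"] that by auto
    then show "inj_on c {..<p}" by (metis inj_onI lessThan_iff nat_le_linear)
    show "range c = c ` {..<p}"
    proof
      show "range c \<subseteq> c ` {..<p}"
      proof (rule image_subsetI)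
        fix t
        have "t mod p \<in> {..<p}" using p(1) by simp
        then show "c t \<in> c ` {..<p}" using per'[of t] by (metis image_eqI)
      qed
    qed blast
  qed
qed

context labeled_tree
begin

lemma root_nbrs_Min: "Min (nbrs E n) \<in> nbrs E n"
  using finite_nbrs nbrs_nonempty[of n] n_ge by (intro Min_in) auto

lemma cw_walk_edge: "{cw_walk n E t, cw_walk n E (Suc t)} \<in> E"
proof (induction t)
  case 0
  then show ?case using root_nbrs_Min by (simp add: nbrs_edge insert_commute)
next
  case (Suc t)
  then show ?case
    using cw_next(1)[of "cw_walk n E t" "cw_walk n E (Suc t)"]
    by (simp add: nbrs_edge insert_commute)
qed

text \<open>The darts met by the walk form an orbit of an injective map, so the walk is periodic; as every
  edge is a bridge, the set of these darts is closed under reversal. Hence it is closed under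
  rotation around a vertex, and by connectedness it contains all darts.\<close>

lemma tour_cw_walk: "tour n E (cw_walk n E)"
proof -
  define w where "w = cw_walk n E"
  define c where "c t = (w t, w (Suc t))" for t
  define f where "f = (\<lambda>(u, v). (v, cw_next n E v u))"
  have step: "c (Suc t) = f (c t)" for t by (simp add: c_def f_def w_def)
  have mem: "c t \<in> adj E" for t using cw_walk_edge by (simp add: c_def w_def)
  have inj: "inj_on f (adj E)"
  proof (rule inj_onI)
    fix x y assume xy: "x \<in> adj E" "y \<in> adj E" "f x = f y"
    obtain u v u' v' where "x = (u, v)" "y = (u', v')" by (cases x, cases y)
    then show "x = y" using xy inj_onD[OF inj_on_cw_next, of v u u'] by (auto simp: f_def nbrs_edge)
  qed
  obtain p where p: "0 < p" "\<And>t. c (t + p) = c t" "inj_on c {..<p}" "range c = c ` {..<p}"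
    using injective_orbit[of "adj E" c f, OF finite_adj mem step inj] by blast
  have wper: "w (t + p) = w t" for t using p(2)[of t] by (simp add: c_def)
  have wedge: "{w t, w (Suc t)} \<in> E" for t using mem[of t] by (simp add: c_def)
  have sub: "range c \<subseteq> adj E" using mem by blast
  have rev: "(v, u) \<in> range c" if uv: "(u, v) \<in> range c" for u v
  proof -
    obtain t where t: "w t = u" "w (Suc t) = v" using uv by (auto simp: c_def)
    then have e: "{u, v} \<in> E" using wedge[of t] by simp
    \<comment> \<open>After the dart from \<open>u\<close> to \<open>v\<close> the walk is on the
      side of \<open>v\<close>; at time \<open>t + p\<close> it is back at \<open>u\<close>. It must
      have crossed the bridge in between.\<close>
    obtain r where r: "w r \<in> comp u v" "w (Suc r) \<notin> comp u v"
    proof (rule exit_step[of "\<lambda>x. x \<in> comp u v" w "Suc t" "t + p"])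
      show "w (Suc t) \<in> comp u v" using t comp_self by simp
      show "w (t + p) \<notin> comp u v" using t wper comp_other[OF e] by simp
    qed (use p(1) in auto)
    then have "w r = v \<and> w (Suc r) = u" using comp_exit[OF e wedge] by blast
    then have "c r = (v, u)" by (simp add: c_def)
    then show ?thesis by (metis rangeI)
  qed
  have outs: "(v, x) \<in> range c" if vu: "(v, u) \<in> range c" and x: "{v, x} \<in> E" for u v x
  proof -
    have "{y \<in> nbrs E v. (v, y) \<in> range c} = nbrs E v"
    proof (rule cw_next_closed_eq)
      have "(v, u) \<in> adj E" using vu sub by blast
      then show "{y \<in> nbrs E v. (v, y) \<in> range c} \<noteq> {}" using vu
        by (auto simp: nbrs_edge insert_commute)
      fix y assume y: "y \<in> {y \<in> nbrs E v. (v, y) \<in> range c}"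
      then have "(y, v) \<in> range c" using rev by blast
      then obtain t where "c t = (y, v)" by auto
      then have "c (Suc t) = (v, cw_next n E v y)" using step by (simp add: f_def)
      then have "(v, cw_next n E v y) \<in> range c" by (metis rangeI)
      then show "cw_next n E v y \<in> {y \<in> nbrs E v. (v, y) \<in> range c}" using y cw_next(1) by simp
    qed simp
    moreover have "x \<in> nbrs E v" using x by (simp add: nbrs_edge insert_commute)
    ultimately show ?thesis by blast
  qed
  have visited: "v \<in> {v. \<exists>u. (v, u) \<in> range c}" if "v \<in> {1..n}" for v
  proof (rule rtrancl_closed)
    show "(n, v) \<in> (adj E)\<^sup>*" using that n_ge by (intro connected) auto
    have "c 0 = (n, w 1)" by (simp add: c_def w_def)
    then show "n \<in> {v. \<exists>u. (v, u) \<in> range c}" by (metis mem_Collect_eq rangeI)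
    fix a b assume "a \<in> {v. \<exists>u. (v, u) \<in> range c}" "(a, b) \<in> adj E"
    then have "(a, b) \<in> range c" using outs unfolding mem_Collect_eq adj_iff by blast
    then show "b \<in> {v. \<exists>u. (v, u) \<in> range c}" using rev by blast
  qed
  have "(u, v) \<in> range c" if "{u, v} \<in> E" for u v
    using visited[OF edgeD(2)[OF that]] outs that unfolding mem_Collect_eq by blast
  then have "range c = adj E" using sub by auto
  then have surj: "c ` {..<p} = adj E" using p(4) by simp
  then have "p = 2 * n - 2" using card_image[OF p(3)] card_adj by simp
  moreover have "w p = n" using wper[of 0] by (simp add: w_def)
  ultimately show ?thesis
    using p(3) surj unfolding c_def w_def
    by unfold_locales (simp_all add: bij_betw_def)
qed

end

section \<open>Clockwise turning and the cyclicity conditions\<close>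

context tour
begin

definition clockwise :: bool where
  "clockwise \<longleftrightarrow> w 1 = Min (nbrs E n) \<and>
    (\<forall>t. Suc t < 2 * n - 2 \<longrightarrow> w (Suc (Suc t)) = cw_next n E (w (Suc t)) (w t))"

lemma clockwise_eq_cw_walk:
  assumes "clockwise" "t \<le> 2 * n - 2"
  shows "w t = cw_walk n E t"
  using assms(2)
proof (induction t rule: less_induct)
  case (less t)
  consider "t = 0" | "t = 1" | r where "t = Suc (Suc r)" 
    by (cases t; cases "t - 1") auto
  then show ?case
  proof cases
    case 1
    then show ?thesis using start by simp
  next
    case 2
    then show ?thesis using assms(1) by (simp add: clockwise_def)
  next
    case 3
    then show ?thesis using assms(1) less by (simp add: clockwise_def)
  qed
qed

lemma outs_root_0: "outs n ! 0 = w 1"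
proof -
  have "0 \<in> set (times n)" using n_ge start by (simp add: set_times)
  then have "times n ! 0 = 0" using sorted_wrt_less_nth_0[OF sorted_times, of 0 n] by simp
  moreover have "0 < length (outs n)" using outs_nonempty[of n] n_ge by auto
  ultimately show ?thesis using outs_nth[of 0 n] by simp
qed

lemma nval_root: "map (nval n E n) xs = xs"
  by (simp add: nval_def map_idI)

text \<open>The parent heads \<open>rots v\<close> and receives the value \<open>v\<close>; the
  other neighbours keep their labels. The result is exactly the list that
  \<open>cyc_cond_iff_rotate\<close> asks to be sorted up to rotation.\<close>

lemma nval_rots:
  assumes v: "v \<in> {1..<n}"
  shows "map (nval n E v) (rots v) = v # butlast (outs v)"
proof -
  have "x \<noteq> parent n E v" if "x \<in> set (butlast (outs v))" for x
    using that last_outs[OF v] distinct_outs[of v] outs_nonempty[of v] v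
    by (metis append_butlast_last_id atLeastAtMost_iff atLeastLessThan_iff distinct_butlast
        not_distinct_conv_prefix less_imp_le append_Nil2)
  then have "map (nval n E v) (butlast (outs v)) = butlast (outs v)"
    by (intro map_idI) (auto simp: nval_def)
  then show ?thesis using v last_outs[OF v] by (simp add: rots_def nval_def)
qed

lemma nvals_rots: "v \<in> {1..n} \<Longrightarrow> set (map (nval n E v) (rots v)) = nvals v"
  by (simp add: set_rots)

text \<open>By \<open>rots_next\<close> consecutive entries of \<open>rots v\<close> are consecutive
  turns of the walk, hence cyclic successors in value. The offset \<open>q\<close> is exported
  because at the root it has to be shown to vanish.\<close>

lemma clockwise_rotate:
  assumes "clockwise" and v: "v \<in> {1..n}"
  obtains q where "map (nval n E v) (rots v) = rotate q (sorted_list_of_set (nvals v))"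
    "nval n E v (rots v ! 0) = sorted_list_of_set (nvals v) ! q" "q < card (nvals v)"
proof -
  let ?zs = "map (nval n E v) (rots v)"
  have "distinct (rots v)"
  proof (rule card_distinct)
    show "card (set (rots v)) = length (rots v)"
      using set_rots[OF v] length_rots[OF v] distinct_card[OF distinct_outs[of v]] set_outs by simp
  qed
  then have len: "length (rots v) = card (nvals v)"
    using distinct_card[of "rots v"] set_rots[OF v] card_image[OF inj_on_nval] by metis
  have ne: "rots v \<noteq> []" using length_rots[OF v] outs_nonempty[OF v] by auto
  have "?zs ! Suc i = csucc (nvals v) (?zs ! i)" if i: "Suc i < card (nvals v)" for i
  proof -
    obtain t where t: "Suc t < 2 * n - 2" "w t = rots v ! i" "w (Suc t) = v"
      "w (Suc (Suc t)) = rots v ! Suc i"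
      using rots_next[OF v] i len by metis
    have "rots v ! Suc i = cw_next n E v (rots v ! i)"
      using assms(1) t unfolding clockwise_def by metis
    moreover have "rots v ! i \<in> nbrs E v"
      using set_rots[OF v] i len by (metis Suc_lessD nth_mem)
    ultimately show ?thesis using cw_next(2) i len by simp
  qed
  moreover have "?zs ! 0 \<in> nvals v"
    using nvals_rots[OF v] ne by (metis length_greater_0_conv length_map nth_mem)
  ultimately obtain q where "q < card (nvals v)" "?zs = rotate q (sorted_list_of_set (nvals v))"
    "?zs ! 0 = sorted_list_of_set (nvals v) ! q"
    using csucc_iterates_rotate[OF finite_nvals, of ?zs v] len by (metis length_map)
  moreover have "?zs ! 0 = nval n E v (rots v ! 0)" using ne by simp
  ultimately show ?thesis using that by metis
qed

lemma sorted_rotate_clockwise: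
  assumes "Suc t < 2 * n - 2" "w (Suc t) = v"
    and q: "sorted_wrt (<) (rotate q (map (nval n E v) (rots v)))"
  shows "w (Suc (Suc t)) = cw_next n E v (w t)"
proof -
  have v: "v \<in> {1..n}" using w_range[of "Suc t"] assms by simp
  obtain i where i: "i < length (rots v)" "w t = rots v ! i"
    "w (Suc (Suc t)) = rots v ! (Suc i mod length (rots v))"
    using rots_after_arrival[OF assms(1,2)] .
  have "Suc i mod length (rots v) < length (rots v)"
    using i(1) by (intro mod_less_divisor) (cases "rots v", auto)
  then have "nval n E v (w (Suc (Suc t))) = csucc (nvals v) (nval n E v (w t))"
    using csucc_sorted_rotate[OF q, of i] i nvals_rots[OF v] by simp
  then show ?thesis
    using edge[of t] edge[of "Suc t"] assms(1,2)
    by (intro cw_nextI[symmetric]) (auto simp: nbrs_edge insert_commute)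
qed

text \<open>Turning clockwise at a vertex fixes the order of departures up to rotation, which is
  condition (ii). At \<open>n\<close> the marked edge also fixes the starting point, which turns
  cyclic increase into the strict increase of (i).\<close>

lemma clockwise_iff:
  "clockwise \<longleftrightarrow> sorted_wrt (<) (map int (outs n)) \<and>
     (\<forall>k. 1 \<le> k \<and> k < n \<longrightarrow> cyc_cond (map int (outs k)) (int k))"
proof -
  have n: "n \<in> {1..n}" using n_ge by simp
  have cyc: "cyc_cond (map int (outs k)) (int k) \<longleftrightarrow>
      (\<exists>q. sorted_wrt (<) (rotate q (map (nval n E k) (rots k))))" if k: "k \<in> {1..<n}" for k
  proof -
    have "rotate q (int k # butlast (map int (outs k))) =
      map int (rotate q (map (nval n E k) (rots k)))" for q
      unfolding nval_rots[OF k] by (simp add: rotate_map[symmetric] map_butlast)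
    then show ?thesis
      using outs_nonempty[of k] k by (simp add: cyc_cond_iff_rotate sorted_wrt_map)
  qed
  show ?thesis
  proof
    assume c: clockwise
    have "sorted_wrt (<) (outs n)"
    proof -
      obtain q where q: "map (nval n E n) (rots n) = rotate q (sorted_list_of_set (nvals n))"
        "nval n E n (rots n ! 0) = sorted_list_of_set (nvals n) ! q" "q < card (nvals n)"
        using clockwise_rotate[OF c n] .
      have nv: "nvals n = nbrs E n" by (simp add: nval_def)
      \<comment> \<open>The first departure from \<open>n\<close> takes the marked edge to the
        smallest neighbour, so the rotation offset is 0.\<close>
      have "sorted_list_of_set (nbrs E n) ! q = Min (nbrs E n)"
        using q(2) outs_root_0 c unfolding nv by (simp add: nval_def rots_def clockwise_def)
      also have "\<dots> = sorted_list_of_set (nbrs E n) ! 0"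
        using sorted_list_of_set_nonempty[OF finite_nbrs] nbrs_nonempty[OF n] by simp
      finally have "q = 0"
        using q(3) unfolding nv by (subst (asm) nth_eq_iff_index_eq) auto
      then have "outs n = sorted_list_of_set (nbrs E n)"
        using q(1) unfolding nv nval_root by (simp add: rots_def)
      then show ?thesis by simp
    qed
    moreover have "cyc_cond (map int (outs k)) (int k)" if k: "k \<in> {1..<n}" for k
    proof -
      obtain q where q: "map (nval n E k) (rots k) = rotate q (sorted_list_of_set (nvals k))"
        using clockwise_rotate[OF c, of k] k by auto
      have "sorted_list_of_set (nvals k) \<noteq> []"
        using finite_nvals nbrs_nonempty[of k] k by (simp add: sorted_list_of_set_eq_Nil_iff)
      then obtain r where "sorted_list_of_set (nvals k) = rotate r (rotate q (sorted_list_of_set (nvals k)))"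
        using rotate_rotate_back by blast
      then have "sorted_wrt (<) (rotate r (map (nval n E k) (rots k)))"
        unfolding q by (metis strict_sorted_list_of_set)
      then show ?thesis using cyc[OF k] by blast
    qed
    ultimately show "sorted_wrt (<) (map int (outs n)) \<and>
      (\<forall>k. 1 \<le> k \<and> k < n \<longrightarrow> cyc_cond (map int (outs k)) (int k))"
      by (simp add: sorted_wrt_map)
  next
    assume a: "sorted_wrt (<) (map int (outs n)) \<and>
      (\<forall>k. 1 \<le> k \<and> k < n \<longrightarrow> cyc_cond (map int (outs k)) (int k))"
    then have s: "sorted_wrt (<) (outs n)" by (simp add: sorted_wrt_map)
    have rot: "\<exists>q. sorted_wrt (<) (rotate q (map (nval n E v) (rots v)))" if v: "v \<in> {1..n}" for v
    proof (cases "v = n")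
      case True
      then have "sorted_wrt (<) (rotate 0 (map (nval n E v) (rots v)))"
        using s nval_root by (simp add: rots_def)
      then show ?thesis by blast
    next
      case False
      then show ?thesis using cyc[of v] a v by auto
    qed
    have "w 1 = Min (nbrs E n)"
    proof (rule Min_eqI[symmetric])
      show "w 1 \<in> nbrs E n" using edge[of 0] start n_ge by (simp add: nbrs_edge insert_commute)
      fix y assume "y \<in> nbrs E n"
      then show "w 1 \<le> y" using sorted_wrt_less_nth_0[OF s, of y] outs_root_0 set_outs by simp
    qed (fact finite_nbrs)
    moreover have "w (Suc (Suc t)) = cw_next n E (w (Suc t)) (w t)" if t: "Suc t < 2 * n - 2" for t
      using rot[OF w_range[of "Suc t"]] sorted_rotate_clockwise[OF t refl] t by auto
    ultimately show clockwise unfolding clockwise_def by blast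
  qed
qed

end

section \<open>The product along an Euler tour\<close>

text \<open>For distinct \<open>x\<close> and \<open>y\<close> in [n], the representative of
  \<open>y - x\<close> modulo \<open>n\<close> strictly between 0 and \<open>n\<close>.\<close>

definition gap :: "nat \<Rightarrow> nat \<Rightarrow> nat \<Rightarrow> int" where
  "gap n x y = (if x < y then int y - int x else int y - int x + int n)"

lemma residue_eq_iff:
  assumes "x \<in> {1..n}" "y \<in> {1..n}"
  shows "int x mod int n = int y mod int n \<longleftrightarrow> x = y"
proof
  have "i = j" if ij: "i \<in> {1..n}" "j \<in> {1..n}" "i \<le> j" "int i mod int n = int j mod int n" for i j
  proof (rule ccontr)
    assume "i \<noteq> j"
    then have pos: "0 < int j - int i" using ij(3) by simp
    have "int n dvd int j - int i" using ij(4) by (metis mod_eq_dvd_iff)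
    then have "int n \<le> int j - int i" using pos by (rule zdvd_imp_le)
    then show False using ij by simp
  qed
  then show "int x mod int n = int y mod int n \<Longrightarrow> x = y"
    using assms by (metis nat_le_linear)
qed simp

lemma gap_sum: "x \<noteq> y \<Longrightarrow> gap n x y + gap n y x = int n"
  by (auto simp: gap_def)

lemma gap_bounds:
  assumes "x \<in> {1..n}" "y \<in> {1..n}" "x \<noteq> y"
  shows "0 < gap n x y" "gap n x y < int n"
  using assms by (auto simp: gap_def)

lemma gap_mod: "(int x + gap n x y) mod int n = int y mod int n"
  by (simp add: gap_def)

lemma gap_unique:
  assumes "0 < d" "d < int n" "(int x + d) mod int n = int y mod int n"
    and "x \<in> {1..n}" "y \<in> {1..n}" "x \<noteq> y"
  shows "d = gap n x y"
proof -
  have "(int x + d) mod int n = (int x + gap n x y) mod int n"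
    using assms(3) gap_mod by simp
  then have "int n dvd (int x + d) - (int x + gap n x y)" by (simp add: mod_eq_dvd_iff)
  then have dv: "int n dvd d - gap n x y" by simp
  then have "d - gap n x y = 0"
    using gap_bounds[OF assms(4-6)] assms(1,2) zdvd_not_zless[of "d - gap n x y" "int n"]
      zdvd_not_zless[of "gap n x y - d" "int n"]
    by (cases "d < gap n x y"; cases "gap n x y < d") (auto simp: dvd_diff_commute)
  then show ?thesis by simp
qed

lemma arefl_apply:
  "z mod int n = a mod int n \<Longrightarrow> arefl n a b z = z + (b - a)"
  "z mod int n \<noteq> a mod int n \<Longrightarrow> z mod int n = b mod int n \<Longrightarrow> arefl n a b z = z - (b - a)"
  "z mod int n \<noteq> a mod int n \<Longrightarrow> z mod int n \<noteq> b mod int n \<Longrightarrow> arefl n a b z = z"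
  by (simp_all add: arefl_def)

lemma arefl_cong:
  assumes "a mod int n = a' mod int n" "b - a = b' - a'"
  shows "arefl n a b = arefl n a' b'"
proof
  fix z
  have "b = a + (b - a)" "b' = a' + (b - a)" using assms(2) by simp_all
  then have "b mod int n = b' mod int n" using assms(1) by (metis mod_add_cong)
  then show "arefl n a b z = arefl n a' b' z"
    using assms unfolding arefl_def by auto
qed

lemma rT_step_arefl: "rT_step n x y = arefl n (int x) (int x + gap n x y)"
proof (cases "x < y")
  case False
  then show ?thesis unfolding rT_step_def gap_def by (auto intro!: arefl_cong)
qed (simp add: rT_step_def gap_def)

lemma rT_step_apply:
  "z mod int n = int x mod int n \<Longrightarrow> rT_step n x y z = z + gap n x y"
  "z mod int n \<noteq> int x mod int n \<Longrightarrow> z mod int n = int y mod int n \<Longrightarrow> rT_step n x y z = z - gap n x y"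
  "z mod int n \<noteq> int x mod int n \<Longrightarrow> z mod int n \<noteq> int y mod int n \<Longrightarrow> rT_step n x y z = z"
  by (simp_all add: rT_step_arefl arefl_apply gap_mod)

text \<open>The class of \<open>x\<close> is the only one that the reflection raises, and the amount
  of the raise determines the class of \<open>y\<close>.\<close>

lemma rT_step_inject:
  assumes "rT_step n x y = rT_step n x' y'" "x \<noteq> y" "x' \<noteq> y'"
    and "x \<in> {1..n}" "y \<in> {1..n}" "x' \<in> {1..n}" "y' \<in> {1..n}"
  shows "x = x' \<and> y = y'"
proof -
  have up: "rT_step n x' y' (int x) = int x + gap n x y"
    using assms(1) rT_step_apply(1)[of "int x" n x y] by simp
  have pos: "0 < gap n x y" "0 < gap n x' y'" using gap_bounds assms by blast+
  have "int x mod int n = int x' mod int n"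
  proof (rule ccontr)
    assume "int x mod int n \<noteq> int x' mod int n"
    then have "rT_step n x' y' (int x) \<le> int x"
      using rT_step_apply(2,3)[of "int x" n x' y'] pos(2)
      by (cases "int x mod int n = int y' mod int n") auto
    then show False using up pos(1) by simp
  qed
  then have x: "x = x'" using residue_eq_iff assms by simp
  then have "gap n x y = gap n x y'" using up rT_step_apply(1)[of "int x" n x y'] by simp
  then have "int y mod int n = int y' mod int n" using gap_mod by metis
  then show ?thesis using x residue_eq_iff assms by simp
qed

lemma md_int: "x \<in> {1..n} \<Longrightarrow> md n (int x) = int x"
  by (simp add: md_def)

lemma md_cong: "i mod int n = j mod int n \<Longrightarrow> md n i = md n j"
  unfolding md_def by (metis mod_diff_left_eq)

lemma nat_md:
  assumes "0 < n"
  shows "nat (md n i) \<in> {1..n}" "int (nat (md n i)) mod int n = i mod int n"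
proof -
  have "0 \<le> (i - 1) mod int n" "(i - 1) mod int n < int n" using assms by simp_all
  then show "nat (md n i) \<in> {1..n}" unfolding md_def by auto
  have "int (nat (md n i)) = (i - 1) mod int n + 1"
    using \<open>0 \<le> (i - 1) mod int n\<close> by (simp add: md_def)
  then show "int (nat (md n i)) mod int n = i mod int n" by (simp add: mod_simps)
qed

lemma prodr_upt:
  "t < m \<Longrightarrow> prodr (map f [t..<m]) z = f t (prodr (map f [Suc t..<m]) z)"
  by (simp add: prodr_def upt_conv_Cons)

lemma rT_map_upt:
  "rT n E = map (\<lambda>t. rT_step n (cw_walk n E t) (cw_walk n E (Suc t))) [0..<2 * n - 2]"
proof (rule nth_equalityI)
  fix i assume "i < length (rT n E)"
  then have i: "i < 2 * n - 2" by (simp add: rT_def)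
  then have "[Suc 0..<2 * n - Suc 0] ! i = Suc i" by (subst nth_upt) auto
  with i show "rT n E ! i = map (\<lambda>t. rT_step n (cw_walk n E t) (cw_walk n E (Suc t))) [0..<2 * n - 2] ! i"
    by (simp add: rT_def)
qed (simp add: rT_def)

section \<open>Every tour multiplies to the element \<open>lam n\<close>\<close>

context tour
begin

definition steps :: "(int \<Rightarrow> int) list" where
  "steps = map (\<lambda>t. rT_step n (w t) (w (Suc t))) [0..<2 * n - 2]"

lemma clockwise_steps: "clockwise \<Longrightarrow> steps = rT n E"
  unfolding steps_def rT_map_upt using clockwise_eq_cw_walk by simp

lemma residue_w:
  "\<lbrakk>s \<le> 2 * n - 2; k \<in> {1..n}\<rbrakk> \<Longrightarrow> int k mod int n = int (w s) mod int n \<longleftrightarrow> k = w s"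
  using residue_eq_iff w_range by blast

text \<open>A dart and its reverse have gaps with sum \<open>n\<close>, and there are
  \<open>n - 1\<close> edges. Adding the sum to its reversal avoids choosing an orientation. The
  total is the amount that \<open>lam n\<close> subtracts on multiples of \<open>n\<close>.\<close>

lemma sum_gap: "(\<Sum>t<2 * n - 2. gap n (w t) (w (Suc t))) = int n * (int n - 1)"
proof -
  have swap: "bij_betw prod.swap (adj E) (adj E)"
    by (rule bij_betw_byWitness[where f' = prod.swap]) (auto simp: insert_commute)
  have "(\<Sum>t<2 * n - 2. gap n (w t) (w (Suc t))) = (\<Sum>p\<in>adj E. gap n (fst p) (snd p))"
    using sum.reindex_bij_betw[OF bij_darts, of "\<lambda>p. gap n (fst p) (snd p)"] by simp
  moreover have "2 * (\<Sum>p\<in>adj E. gap n (fst p) (snd p)) =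
      (\<Sum>p\<in>adj E. gap n (fst p) (snd p) + gap n (snd p) (fst p))"
    using sum.reindex_bij_betw[OF swap, of "\<lambda>p. gap n (fst p) (snd p)"]
    by (simp add: sum.distrib)
  moreover have "\<dots> = (\<Sum>p\<in>adj E. int n)"
    using edgeD(1) by (intro sum.cong gap_sum) auto
  moreover have "int (card (adj E)) = 2 * (int n - 1)" using n_ge by (simp add: card_adj of_nat_diff)
  then have "(\<Sum>p\<in>adj E. int n) = 2 * (int n * (int n - 1))"
    by (simp only: sum_constant) simp
  ultimately show ?thesis by linarith
qed

text \<open>Read from right to left, the factors carry the class of n along the whole walk, downwards.\<close>

lemma prodr_steps_root:
  assumes z: "z mod int n = 0"
  shows "prodr steps z = z - int n * (int n - 1)"
proof -
  let ?P = "\<lambda>t. prodr (map (\<lambda>t. rT_step n (w t) (w (Suc t))) [t..<2 * n - 2]) z"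
  have "?P t = z - (\<Sum>r=t..<2 * n - 2. gap n (w r) (w (Suc r))) \<and> ?P t mod int n = int (w t) mod int n"
    if "t \<le> 2 * n - 2" for t
    using that
  proof (induction rule: inc_induct)
    case base
    then show ?case using z finish by (simp add: prodr_def)
  next
    case (step t)
    then have P: "?P t = rT_step n (w t) (w (Suc t)) (?P (Suc t))" by (intro prodr_upt)
    have "w t \<noteq> w (Suc t)" using edgeD(1)[OF edge[OF step(2)]] .
    then have ne: "?P (Suc t) mod int n \<noteq> int (w t) mod int n"
      using step residue_eq_iff[OF w_range[of t] w_range[of "Suc t"]] by auto
    have Pt: "?P t = ?P (Suc t) - gap n (w t) (w (Suc t))"
      unfolding P using ne step.IH by (intro rT_step_apply(2)) auto
    have "?P t mod int n = (int (w (Suc t)) - gap n (w t) (w (Suc t))) mod int n"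
      unfolding Pt using step.IH by (metis mod_diff_left_eq)
    also have "\<dots> = ((int (w t) + gap n (w t) (w (Suc t))) - gap n (w t) (w (Suc t))) mod int n"
      using gap_mod by (metis mod_diff_left_eq)
    finally show ?case
      using Pt step.IH step(2) by (simp add: sum.atLeast_Suc_lessThan)
  qed
  from this[of 0] show ?thesis using sum_gap by (simp add: steps_def atLeast0LessThan)
qed

text \<open>The class of k < n moves only when the walk crosses the edge from k to its parent, once
  in either direction; it stays at the parent while the walk is inside the subtree of k.\<close>

lemma prodr_steps_nonroot:
  assumes k: "k \<in> {1..<n}" and z: "z mod int n = int k mod int n"
  shows "prodr steps z = z + int n"
proof -
  let ?P = "\<lambda>t. prodr (map (\<lambda>t. rT_step n (w t) (w (Suc t))) [t..<2 * n - 2]) z"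
  let ?p = "parent n E k"
  obtain s e where se: "s < e" "e < 2 * n - 2" "w s = ?p" "w (Suc s) = k"
    "w e = k" "w (Suc e) = ?p" "\<And>t. t \<le> 2 * n - 2 \<Longrightarrow> w t \<in> desc k \<longleftrightarrow> s < t \<and> t \<le> e"
    using desc_interval[OF k] by blast
  have kn: "k \<in> {1..n}" using k by auto
  have pn: "?p \<in> {1..n}" and pk: "?p \<noteq> k" using edgeD[OF parent_edge(1)[OF k]] by auto
  have P: "?P t = rT_step n (w t) (w (Suc t)) (?P (Suc t))" if "t < 2 * n - 2" for t
    using that by (intro prodr_upt)
  have stay: "?P t = ?P (Suc t)"
    if "t < 2 * n - 2" "?P (Suc t) mod int n = int x mod int n" "x \<in> {1..n}" "x \<noteq> w t" "x \<noteq> w (Suc t)"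
    for t x
    unfolding P[OF that(1)] using that residue_w[of t x] residue_w[of "Suc t" x]
    by (intro rT_step_apply(3)) auto
  have late: "?P t = z" if "t \<le> 2 * n - 2" "e < t" for t
    using that
  proof (induction rule: inc_induct)
    case base
    then show ?case by (simp add: prodr_def)
  next
    case (step t)
    have "k \<noteq> w t" "k \<noteq> w (Suc t)"
      using se(7)[of t] se(7)[of "Suc t"] step desc_self by auto
    then show ?case using stay[of t k] step z kn by simp
  qed
  have Pe: "?P e = z + gap n k ?p"
    using P[OF se(2)] late[of "Suc e"] se z by (simp add: rT_step_apply(1))
  have at_parent: "(z + gap n k ?p) mod int n = int ?p mod int n"
    using z gap_mod[of k n ?p] by (metis mod_add_left_eq)
  have middle: "?P t = z + gap n k ?p" if "t \<le> e" "s < t" for t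
    using that
  proof (induction rule: inc_induct)
    case base
    then show ?case using Pe by simp
  next
    case (step t)
    have "?p \<noteq> w t" "?p \<noteq> w (Suc t)"
      using se(2) se(7)[of t] se(7)[of "Suc t"] step parent_notin_desc[OF k] by auto
    then show ?case using stay[of t ?p] step at_parent pn se(2) by simp
  qed
  have "?P (Suc s) = z + gap n k ?p" using middle[of "Suc s"] se(1) by simp
  then have "?P s = z + gap n k ?p + gap n ?p k"
    using P[of s] se at_parent by (simp add: rT_step_apply(1))
  then have Ps: "?P s = z + int n" using gap_sum[OF pk, of n] by simp
  have early: "?P t = z + int n" if "t \<le> s" for t
    using that
  proof (induction rule: inc_induct)
    case base
    then show ?case using Ps by simp
  next
    case (step t)
    have "k \<noteq> w t" "k \<noteq> w (Suc t)"
      using se(1,2) se(7)[of t] se(7)[of "Suc t"] step desc_self by auto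
    then show ?case using stay[of t k] step z kn se(1,2) by simp
  qed
  from early[of 0] show ?thesis by (simp add: steps_def)
qed

lemma prodr_steps: "prodr steps = lam n"
proof
  fix z
  show "prodr steps z = lam n z"
  proof (cases "z mod int n = 0")
    case True
    then show ?thesis using prodr_steps_root by (simp add: lam_def)
  next
    case False
    define k where "k = nat (z mod int n)"
    have "0 \<le> z mod int n" "z mod int n < int n" using n_ge by simp_all
    then have "k \<in> {1..<n}" "z mod int n = int k mod int n" using False by (auto simp: k_def)
    then show ?thesis using prodr_steps_nonroot False by (simp add: lam_def)
  qed
qed

text \<open>Only the residues of \<open>a\<close> and \<open>b\<close> enter, so the lemma serves
  the explicit witnesses built from a tour as well as the unknown witnesses of a given
  factorization.\<close>

lemma Nlist_outs:
  assumes a: "\<And>t. t < 2 * n - 2 \<Longrightarrow> a t mod int n = int (w t) mod int n"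
    and b: "\<And>t. t < 2 * n - 2 \<Longrightarrow> b (Suc t) mod int n = int (w (Suc t)) mod int n"
    and k: "k \<in> {1..n}"
  shows "Nlist n (2 * n - 2) a b (int k) = map int (outs k)"
proof -
  have upt: "[1..<2 * n - 2 + 1] = map Suc [0..<2 * n - 2]" by (simp add: map_Suc_upt)
  have "filter (\<lambda>i. a (i - 1) mod int n = int k mod int n) (map Suc [0..<2 * n - 2]) =
      map Suc (times k)"
  proof -
    have "a t mod int n = int k mod int n \<longleftrightarrow> w t = k" if "t < 2 * n - 2" for t
      using a[OF that] residue_w[of t k] k that by auto
    then show ?thesis
      unfolding times_def filter_map by (auto intro!: arg_cong[of _ _ "map Suc"] filter_cong)
  qed
  moreover have "md n (b (Suc t)) = int (w (Suc t))" if "t \<in> set (times k)" for t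
    using that b[of t] md_cong md_int w_range[of "Suc t"] by (metis Suc_leI set_times)
  ultimately show ?thesis unfolding Nlist_def upt outs_def by simp
qed

lemma cyclic_fact_steps:
  assumes clockwise
  shows "cyclic_fact n steps"
proof -
  \<comment> \<open>These witnesses follow the two cases of \<open>rT_step\<close>: where the walk
    descends, subtracting \<open>n\<close> puts \<open>a t\<close> below
    \<open>b (Suc t)\<close>.\<close>
  define a where "a t = (if w t < w (Suc t) then int (w t) else int (w t) - int n)" for t
  define b where "b t = int (w t)" for t
  have len: "length steps = 2 * n - 2" by (simp add: steps_def)
  have a_mod: "a t mod int n = int (w t) mod int n" for t by (simp add: a_def)
  have nth: "steps ! t = arefl n (a t) (b (Suc t))" if "t < 2 * n - 2" for t
    using that by (simp add: steps_def rT_step_def a_def b_def)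
  have ne: "a t mod int n \<noteq> b (Suc t) mod int n" if "t < 2 * n - 2" for t
    using residue_w[of "Suc t" "w t"] w_range[of t] edgeD(1)[OF edge[OF that]] that
    by (simp add: a_mod b_def)
  have less: "a t < b (Suc t)" if "t < 2 * n - 2" for t
    using w_range[of t] w_range[of "Suc t"] that by (auto simp: a_def b_def)
  have "is_fact n steps"
    unfolding is_fact_def
  proof (intro conjI ballI)
    fix r assume "r \<in> set steps"
    then obtain t where "t < 2 * n - 2" "r = steps ! t" using len by (metis in_set_conv_nth)
    then show "is_refl n r" unfolding is_refl_def using nth ne by blast
  qed (use len prodr_steps in auto)
  moreover have "tree_like_wit n steps a b"
    unfolding tree_like_wit_def len
  proof (intro conjI ballI)
    fix i assume i: "i \<in> {1..2 * n - 2}"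
    then obtain t where "i = Suc t" "t < 2 * n - 2" by (cases i) auto
    then show "a (i - 1) < b i" "a (i - 1) mod int n \<noteq> b i mod int n"
      "steps ! (i - 1) = arefl n (a (i - 1)) (b i)"
      using less ne nth by simp_all
  qed (simp add: a_mod b_def)
  moreover have N: "Nlist n (length steps) a b (int k) = map int (outs k)" if "k \<in> {1..n}" for k
    unfolding len by (rule Nlist_outs) (use that in \<open>simp_all add: a_mod b_def\<close>)
  moreover have "sorted_wrt (<) (Nlist n (length steps) a b (int n))"
    using N[of n] assms n_ge unfolding clockwise_iff by simp
  moreover have "cyc_cond (Nlist n (length steps) a b (int k)) (int k)" if "1 \<le> k \<and> k < n" for k
    using N[of k] assms that unfolding clockwise_iff by simp
  ultimately show ?thesis unfolding cyclic_fact_def by blast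
qed

lemma edges_eq: "E = (\<lambda>t. {w t, w (Suc t)}) ` {..<2 * n - 2}"
proof
  show "E \<subseteq> (\<lambda>t. {w t, w (Suc t)}) ` {..<2 * n - 2}"
  proof
    fix x assume x: "x \<in> E"
    then have "\<exists>u v. x = {u, v}" using tree unfolding is_tree_def by metis
    then obtain u v where uv: "x = {u, v}" by blast
    then obtain t where "t < 2 * n - 2" "w t = u" "w (Suc t) = v" using x dart_obtain by metis
    then show "x \<in> (\<lambda>t. {w t, w (Suc t)}) ` {..<2 * n - 2}" using uv by auto
  qed
  show "(\<lambda>t. {w t, w (Suc t)}) ` {..<2 * n - 2} \<subseteq> E" using edge by auto
qed

end

section \<open>From trees to cyclic factorizations, injectively\<close>

context labeled_tree
begin

lemma cyclic_fact_rT: "cyclic_fact n (rT n E)"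
proof -
  interpret tour n E "cw_walk n E" by (rule tour_cw_walk)
  have clockwise by (simp add: clockwise_def)
  then show ?thesis using cyclic_fact_steps clockwise_steps by simp
qed

end

text \<open>Each factor determines its dart by \<open>rT_step_inject\<close>, and a tour covers
  every edge of its tree.\<close>

lemma inj_on_rT:
  assumes "2 \<le> n"
  shows "inj_on (rT n) {E. is_tree n E}"
proof (rule inj_onI)
  fix E E' assume "E \<in> {E. is_tree n E}" "E' \<in> {E. is_tree n E}" and eq: "rT n E = rT n E'"
  then interpret T: labeled_tree n E + T': labeled_tree n E'
    using assms by unfold_locales simp_all
  interpret T: tour n E "cw_walk n E" by (rule T.tour_cw_walk)
  interpret T': tour n E' "cw_walk n E'" by (rule T'.tour_cw_walk)
  have "cw_walk n E t = cw_walk n E' t \<and> cw_walk n E (Suc t) = cw_walk n E' (Suc t)"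
    if t: "t < 2 * n - 2" for t
  proof (rule rT_step_inject)
    show "rT_step n (cw_walk n E t) (cw_walk n E (Suc t)) =
        rT_step n (cw_walk n E' t) (cw_walk n E' (Suc t))"
      using arg_cong[OF eq, of "\<lambda>xs. xs ! t"] t by (simp add: rT_map_upt)
  qed (use t T.w_range[of t] T.w_range[of "Suc t"] T'.w_range[of t] T'.w_range[of "Suc t"]
      T.edgeD(1)[OF T.edge[OF t]] T'.edgeD(1)[OF T'.edge[OF t]] in auto)
  then show "E = E'" by (subst T.edges_eq, subst T'.edges_eq) (intro image_cong, auto)
qed

section \<open>From tree-like factorizations to trees\<close>

locale tree_like_factorization =
  fixes n :: nat and rs :: "(int \<Rightarrow> int) list" and a b :: "nat \<Rightarrow> int"
  assumes n_ge: "2 \<le> n" and fact: "is_fact n rs" and wit: "tree_like_wit n rs a b"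
begin

text \<open>The classes of \<open>a_0\<close>, \<open>a_1\<close>, and so on, closed off by the
  class of the last \<open>b\<close>, since the final time has no \<open>a\<close> of its
  own.\<close>

definition w :: "nat \<Rightarrow> nat" where
  "w t = nat (md n (if t < 2 * n - 2 then a t else b t))"

text \<open>Only positivity is known at first; \<open>d t < int n\<close> comes out of
  \<open>reverse_step\<close>.\<close>

definition d :: "nat \<Rightarrow> int" where
  "d t = b (Suc t) - a t"

text \<open>The partial product of the factors from \<open>t\<close> on. Lowering \<open>t\<close>
  from \<open>2 * n - 2\<close> to 0 follows a point through the product read from the
  right.\<close>

definition tail :: "nat \<Rightarrow> int \<Rightarrow> int" where
  "tail t = prodr (map ((!) rs) [t..<2 * n - 2])"

lemma len: "length rs = 2 * n - 2"
  using fact by (simp add: is_fact_def)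

lemma factor:
  assumes "t < 2 * n - 2"
  shows "a t < b (Suc t)" "a t mod int n \<noteq> b (Suc t) mod int n" "rs ! t = arefl n (a t) (b (Suc t))"
proof -
  have "Suc t \<in> {1..length rs}" using assms len by simp
  then show "a t < b (Suc t)" "a t mod int n \<noteq> b (Suc t) mod int n"
    "rs ! t = arefl n (a t) (b (Suc t))"
    using wit unfolding tree_like_wit_def by force+
qed

lemma n_pos: "0 < n"
  using n_ge by simp

lemma walk_range: "w t \<in> {1..n}"
  unfolding w_def by (rule nat_md(1)[OF n_pos])

lemma w_a: "t < 2 * n - 2 \<Longrightarrow> int (w t) mod int n = a t mod int n"
  by (simp only: w_def nat_md(2)[OF n_pos] if_True)

lemma w_b:
  assumes "t < 2 * n - 2"
  shows "int (w (Suc t)) mod int n = b (Suc t) mod int n"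
proof (cases "Suc t < 2 * n - 2")
  case True
  then have "a (Suc t) mod int n = b (Suc t) mod int n"
    using wit unfolding tree_like_wit_def len by simp
  then show ?thesis using w_a[OF True] by simp
next
  case False
  then show ?thesis by (simp only: w_def nat_md(2)[OF n_pos] if_False)
qed

lemma d_pos: "t < 2 * n - 2 \<Longrightarrow> 0 < d t"
  using factor(1) by (simp add: d_def)

lemma d_mod: "t < 2 * n - 2 \<Longrightarrow> (int (w t) + d t) mod int n = int (w (Suc t)) mod int n"
proof -
  assume t: "t < 2 * n - 2"
  have "(int (w t) + d t) mod int n = (a t + d t) mod int n" using w_a[OF t] by (metis mod_add_left_eq)
  then show ?thesis using w_b[OF t] by (simp add: d_def)
qed

lemma w_neq:
  assumes "t < 2 * n - 2"
  shows "w t \<noteq> w (Suc t)"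
proof
  assume "w t = w (Suc t)"
  then have "a t mod int n = b (Suc t) mod int n" using w_a[OF assms] w_b[OF assms] by simp
  then show False using factor(2)[OF assms] by simp
qed

lemma tail_end: "tail (2 * n - 2) z = z"
  by (simp add: tail_def prodr_def)

lemma tail_0: "tail 0 z = lam n z"
proof -
  have "map ((!) rs) [0..<2 * n - 2] = rs" using map_nth[of rs] len by simp
  then show ?thesis using fact by (simp add: tail_def is_fact_def)
qed

lemma tail_Suc:
  assumes "t < 2 * n - 2"
  shows "tail t z = arefl n (a t) (b (Suc t)) (tail (Suc t) z)"
  unfolding tail_def using prodr_upt[OF assms] factor(3)[OF assms] by simp

lemma tail_up:
  assumes "t < 2 * n - 2" "tail (Suc t) z mod int n = int (w t) mod int n"
  shows "tail t z = tail (Suc t) z + d t"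
  unfolding tail_Suc[OF assms(1)] d_def using assms(2) w_a[OF assms(1)] by (intro arefl_apply(1)) simp

lemma tail_down:
  assumes "t < 2 * n - 2" "tail (Suc t) z mod int n = int (w (Suc t)) mod int n"
  shows "tail t z = tail (Suc t) z - d t"
  unfolding tail_Suc[OF assms(1)] d_def
  using assms(2) w_b[OF assms(1)] factor(2)[OF assms(1)] by (intro arefl_apply(2)) simp_all

lemma tail_stay:
  assumes "t < 2 * n - 2" "tail (Suc t) z mod int n \<noteq> int (w t) mod int n"
    "tail (Suc t) z mod int n \<noteq> int (w (Suc t)) mod int n"
  shows "tail t z = tail (Suc t) z"
  unfolding tail_Suc[OF assms(1)]
  using assms w_b[OF assms(1)] w_a[OF assms(1)] by (intro arefl_apply(3)) simp_all

text \<open>Factor \<open>t\<close> lowers a point in the class of \<open>w (Suc t)\<close> by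
  \<open>d t\<close> into the class of \<open>w t\<close>, which is where the next factor to the
  left finds it.\<close>

lemma tail_walker:
  assumes "z mod int n = int (w (2 * n - 2)) mod int n" "t \<le> 2 * n - 2"
  shows "tail t z mod int n = int (w t) mod int n \<and> tail t z \<le> z \<and> (t < 2 * n - 2 \<longrightarrow> tail t z < z)"
  using assms(2)
proof (induction rule: inc_induct)
  case base
  then show ?case using assms(1) by (simp add: tail_end)
next
  case (step t)
  have down: "tail t z = tail (Suc t) z - d t" using step by (intro tail_down) auto
  have "tail t z mod int n = (int (w t) + d t - d t) mod int n"
    unfolding down using step.IH d_mod[OF step(2)] by (metis mod_diff_left_eq)
  then show ?case using down step.IH d_pos[OF step(2)] by simp
qed

text \<open>The class followed along the whole product strictly decreases, which for lambda only the
  class of n does.\<close>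

lemma w_end: "w (2 * n - 2) = n" and w_0: "w 0 = n"
proof -
  let ?z = "int (w (2 * n - 2))"
  have t0: "lam n ?z mod int n = int (w 0) mod int n" "lam n ?z < ?z"
    using tail_walker[of ?z 0] tail_0[of ?z] n_ge by auto
  have z: "?z mod int n = 0"
  proof (rule ccontr)
    assume "?z mod int n \<noteq> 0"
    then show False using t0(2) by (simp add: lam_def)
  qed
  then show "w (2 * n - 2) = n"
    using residue_eq_iff[OF walk_range[of "2 * n - 2"], of n] n_ge by simp
  have "lam n ?z mod int n = ?z mod int n"
    using z by (simp add: lam_def mod_diff_right_eq[symmetric, of _ "int n * (int n - 1)"])
  then have "int (w 0) mod int n = int n mod int n" using t0(1) z by simp
  then show "w 0 = n" using residue_eq_iff[OF walk_range[of 0], of n] n_ge by simp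
qed

text \<open>Each factor swaps two residue classes and fixes the others, which is
  \<open>moved\<close>, so partial products never merge classes.\<close>

lemma tail_inj:
  assumes "tail t z mod int n = tail t z' mod int n" "t \<le> 2 * n - 2"
  shows "z mod int n = z' mod int n"
  using assms(2,1)
proof (induction rule: inc_induct)
  case base
  then show ?case by (simp add: tail_end)
next
  case (step t)
  have t: "t < 2 * n - 2" by (fact step(2))
  let ?u = "int (w t)" and ?v = "int (w (Suc t))"
  have moved: "(tail (Suc t) x mod int n = ?u mod int n \<and> tail t x mod int n = ?v mod int n) \<or>
      (tail (Suc t) x mod int n = ?v mod int n \<and> tail t x mod int n = ?u mod int n) \<or>
      (tail (Suc t) x mod int n \<notin> {?u mod int n, ?v mod int n} \<and> tail t x = tail (Suc t) x)" for x
  proof -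
    consider "tail (Suc t) x mod int n = ?u mod int n" | "tail (Suc t) x mod int n = ?v mod int n"
      | "tail (Suc t) x mod int n \<notin> {?u mod int n, ?v mod int n}" by blast
    then show ?thesis
    proof cases
      case 1
      then have "tail t x mod int n = (?u + d t) mod int n"
        using tail_up[OF t 1] by (metis mod_add_left_eq)
      then show ?thesis using 1 d_mod[OF t] by simp
    next
      case 2
      then have "tail t x mod int n = (?v - d t) mod int n"
        using tail_down[OF t 2] by (metis mod_diff_left_eq)
      also have "\<dots> = (?u + d t - d t) mod int n" using d_mod[OF t] by (metis mod_diff_left_eq)
      finally show ?thesis using 2 by simp
    next
      case 3
      then show ?thesis using tail_stay[OF t, of x] by simp
    qed
  qed
  have "?u mod int n \<noteq> ?v mod int n"
    using w_neq[OF t] residue_eq_iff[OF walk_range walk_range] by blast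
  then have "tail (Suc t) z mod int n = tail (Suc t) z' mod int n"
    using moved[of z] moved[of z'] step.prems by auto
  then show ?case by (rule step.IH)
qed

text \<open>The times at which the class of \<open>k\<close> is raised. They are compared with the
  position just before factor \<open>t\<close> acts, hence \<open>Suc t\<close>.\<close>

definition moves :: "nat \<Rightarrow> nat set" where
  "moves k = {t. t < 2 * n - 2 \<and> tail (Suc t) (int k) mod int n = int (w t) mod int n}"

lemma finite_moves: "finite (moves k)"
  by (simp add: moves_def)

lemma tail_nonroot:
  assumes k: "k \<in> {1..<n}" and t: "t \<le> 2 * n - 2"
  shows "tail t (int k) = int k + (\<Sum>r\<in>{r \<in> moves k. t \<le> r}. d r)"
  using t
proof (induction rule: inc_induct)
  case base
  have "{r \<in> moves k. 2 * n - 2 \<le> r} = {}" by (auto simp: moves_def)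
  then show ?case by (simp only: tail_end) simp
next
  case (step t)
  have t: "t < 2 * n - 2" by (fact step(2))
  \<comment> \<open>The class of \<open>w (Suc t)\<close> is occupied by the class of
    \<open>n\<close>, which follows the walk. By \<open>tail_inj\<close> the class of
    \<open>k\<close> cannot be there, so it is never lowered.\<close>
  have ne: "tail (Suc t) (int k) mod int n \<noteq> int (w (Suc t)) mod int n"
  proof
    assume "tail (Suc t) (int k) mod int n = int (w (Suc t)) mod int n"
    also have "\<dots> = tail (Suc t) (int n) mod int n"
      using tail_walker[of "int n" "Suc t"] w_end t by simp
    finally have "int k mod int n = int n mod int n" by (rule tail_inj) (use t in simp)
    then have "k = n" using residue_eq_iff[of k n n] k by auto
    then show False using k by simp
  qed
  show ?case
  proof (cases "t \<in> moves k")
    case True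
    then have "{r \<in> moves k. t \<le> r} = insert t {r \<in> moves k. Suc t \<le> r}" by auto
    moreover have "tail t (int k) = tail (Suc t) (int k) + d t"
      using True t by (intro tail_up) (auto simp: moves_def)
    ultimately show ?thesis using step.IH finite_moves by simp
  next
    case False
    then have "t \<le> r \<longleftrightarrow> Suc t \<le> r" if "r \<in> moves k" for r
      using that by (metis Suc_le_eq le_less)
    then have "{r \<in> moves k. t \<le> r} = {r \<in> moves k. Suc t \<le> r}" by blast
    moreover have "tail t (int k) = tail (Suc t) (int k)"
      using False t ne by (intro tail_stay) (auto simp: moves_def)
    ultimately show ?thesis using step.IH by simp
  qed
qed

lemma sum_moves:
  assumes k: "k \<in> {1..<n}"
  shows "(\<Sum>r\<in>moves k. d r) = int n"
proof -
  have "int k + (\<Sum>r\<in>moves k. d r) = lam n (int k)"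
    using tail_nonroot[OF k, of 0] by (simp add: tail_0)
  moreover have "lam n (int k) = int k + int n" using k by (simp add: lam_def)
  ultimately show ?thesis by simp
qed

lemma d_not_n: "t < 2 * n - 2 \<Longrightarrow> d t \<noteq> int n"
  using d_mod[of t] w_neq[of t] residue_eq_iff[OF walk_range walk_range] by auto

text \<open>The lengths of the moves add up to \<open>n\<close>. No move gives 0, and a single move
  of length \<open>n\<close> would not change the class.\<close>

lemma card_moves_ge:
  assumes k: "k \<in> {1..<n}"
  shows "2 \<le> card (moves k)"
proof (rule ccontr)
  assume "\<not> ?thesis"
  then consider "card (moves k) = 0" | "card (moves k) = 1" by linarith
  then show False
  proof cases
    case 1
    then show False using sum_moves[OF k] finite_moves n_ge by simp
  next
    case 2
    then obtain t where t: "moves k = {t}" by (rule card_1_singletonE)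
    then have "t < 2 * n - 2" by (auto simp: moves_def)
    then show False using sum_moves[OF k] t d_not_n by simp
  qed
qed

lemma moves_disjoint:
  assumes "k \<in> {1..<n}" "l \<in> {1..<n}" "t \<in> moves k" "t \<in> moves l"
  shows "k = l"
proof -
  have "tail (Suc t) (int k) mod int n = tail (Suc t) (int l) mod int n" "Suc t \<le> 2 * n - 2"
    using assms(3,4) by (auto simp: moves_def)
  then have "int k mod int n = int l mod int n" by (rule tail_inj)
  then show ?thesis using residue_eq_iff[of k n l] assms(1,2) by simp
qed

text \<open>There are n - 1 classes other than that of n, each must move at least twice, and only
  2 n - 2 moves are available.\<close>

lemma card_moves: "k \<in> {1..<n} \<Longrightarrow> card (moves k) = 2"
  and Union_moves: "(\<Union>k\<in>{1..<n}. moves k) = {..<2 * n - 2}"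
proof -
  have sub: "(\<Union>k\<in>{1..<n}. moves k) \<subseteq> {..<2 * n - 2}" by (auto simp: moves_def)
  have card_Union: "card (\<Union>k\<in>{1..<n}. moves k) = (\<Sum>k\<in>{1..<n}. card (moves k))"
    using finite_moves moves_disjoint by (intro card_UN_disjoint) blast+
  then have le: "(\<Sum>k\<in>{1..<n}. card (moves k)) \<le> 2 * n - 2"
    using card_mono[OF _ sub] by simp
  have two: "(\<Sum>k\<in>{1..<n}. 2) = 2 * n - 2" by simp
  have eq: "\<forall>k\<in>{1..<n}. card (moves k) = 2"
  proof (rule ccontr)
    assume "\<not> ?thesis"
    then have "\<exists>k\<in>{1..<n}. 2 < card (moves k)" using card_moves_ge by (metis le_neq_implies_less)
    then have "(\<Sum>k\<in>{1..<n}. 2) < (\<Sum>k\<in>{1..<n}. card (moves k))"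
      using card_moves_ge by (intro sum_strict_mono_ex1) auto
    then show False using le two by simp
  qed
  then show "k \<in> {1..<n} \<Longrightarrow> card (moves k) = 2" by blast
  have "card (\<Union>k\<in>{1..<n}. moves k) = card {..<2 * n - 2}"
    unfolding card_Union using eq two by simp
  then show "(\<Union>k\<in>{1..<n}. moves k) = {..<2 * n - 2}" using sub by (intro card_subset_eq) auto
qed

text \<open>The later time \<open>e\<close> acts first. The class of \<open>k\<close> is then still
  at home, so \<open>w e = k\<close>; it rests at \<open>w (Suc e)\<close> until time
  \<open>s\<close>, so \<open>w s\<close> is the same vertex; the total length \<open>n\<close>
  brings it home again.\<close>

lemma moves_pair:
  assumes k: "k \<in> {1..<n}"
  obtains s e where "s < e" "e < 2 * n - 2" "moves k = {s, e}" "w e = k" "w (Suc s) = k"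
    "w s = w (Suc e)" "d s + d e = int n"
proof -
  have "\<exists>s e. moves k = {s, e} \<and> s < e"
    using card_moves[OF k] by (metis card_2_iff insert_commute linorder_neqE_nat)
  then obtain s e where m: "moves k = {s, e}" and se: "s < e" by blast
  have lt: "s < 2 * n - 2" "e < 2 * n - 2"
    and at: "tail (Suc s) (int k) mod int n = int (w s) mod int n"
      "tail (Suc e) (int k) mod int n = int (w e) mod int n"
    using m by (auto simp: moves_def)
  have kn: "k \<in> {1..n}" using k by simp
  have late: "{r \<in> moves k. Suc e \<le> r} = {}" "{r \<in> moves k. Suc s \<le> r} = {e}"
    using m se by auto
  have te: "tail (Suc e) (int k) = int k" and ts: "tail (Suc s) (int k) = int k + d e"
    using tail_nonroot[OF k, of "Suc e", unfolded late] tail_nonroot[OF k, of "Suc s", unfolded late] lt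
    by simp_all
  have sum: "d s + d e = int n" using sum_moves[OF k] m se by simp
  have we: "w e = k" using at(2) te residue_eq_iff[OF kn walk_range] by simp
  have ws: "w s = w (Suc e)"
    using at(1) ts d_mod[OF lt(2)] we residue_eq_iff[OF walk_range walk_range] by simp
  have "int (w (Suc s)) mod int n = (int (w (Suc e)) + d s) mod int n"
    using d_mod[OF lt(1)] ws by simp
  also have "\<dots> = (int k + d e + d s) mod int n"
    using d_mod[OF lt(2)] we by (metis mod_add_left_eq)
  also have "\<dots> = (int k + int n) mod int n" using sum by (simp add: ac_simps)
  finally have "w (Suc s) = k" using residue_eq_iff[OF walk_range kn] by simp
  then show ?thesis using that se lt m we ws sum by blast
qed

text \<open>Each time is one of the two moves of some class, and the other move runs back. The two
  lengths are positive with sum \<open>n\<close>, which bounds each.\<close>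

lemma reverse_step:
  assumes "t < 2 * n - 2"
  obtains r where "r < 2 * n - 2" "w r = w (Suc t)" "w (Suc r) = w t" "d t < int n"
proof -
  obtain k where k: "k \<in> {1..<n}" "t \<in> moves k" using assms Union_moves by blast
  obtain s e where se: "s < e" "e < 2 * n - 2" "moves k = {s, e}" "w e = k" "w (Suc s) = k"
    "w s = w (Suc e)" "d s + d e = int n" using moves_pair[OF k(1)] .
  have "0 < d s" "0 < d e" using d_pos se by auto
  moreover have "t = s \<or> t = e" using k(2) se(3) by simp
  ultimately show ?thesis using that[of s] that[of e] se by auto
qed

definition edges :: "nat set set" where
  "edges = (\<lambda>t. {w t, w (Suc t)}) ` {..<2 * n - 2}"

lemma edgeI: "t < 2 * n - 2 \<Longrightarrow> {w t, w (Suc t)} \<in> edges"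
  by (simp add: edges_def)

lemma card_edges_le: "card edges \<le> n - 1"
proof -
  have "\<exists>x. \<forall>t\<in>moves k. {w t, w (Suc t)} = {k, x}" if k: "k \<in> {1..<n}" for k
  proof -
    obtain s e where "moves k = {s, e}" "w e = k" "w (Suc s) = k" "w s = w (Suc e)"
      using moves_pair[OF k] .
    then have "\<forall>t\<in>moves k. {w t, w (Suc t)} = {k, w (Suc e)}" by (auto simp: insert_commute)
    then show ?thesis by blast
  qed
  then obtain x where x: "\<And>k t. k \<in> {1..<n} \<Longrightarrow> t \<in> moves k \<Longrightarrow> {w t, w (Suc t)} = {k, x k}"
    by metis
  have "edges \<subseteq> (\<lambda>k. {k, x k}) ` {1..<n}"
    unfolding edges_def Union_moves[symmetric] using x by blast
  then have "card edges \<le> card {1..<n}" by (metis surj_card_le finite_atLeastLessThan)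
  then show ?thesis by simp
qed

text \<open>The walk visits every vertex because each class has a move starting at home.
  Connectedness then gives at least \<open>n - 1\<close> edges, while \<open>card_edges_le\<close>
  gives at most that many, one per pair of moves.\<close>

lemma is_tree_edges: "is_tree n edges"
proof -
  have fin: "finite edges" by (simp add: edges_def)
  have walk: "(n, w t) \<in> (adj edges)\<^sup>*" if "t \<le> 2 * n - 2" for t
    using that
  proof (induction t)
    case 0
    then show ?case by (simp add: w_0)
  next
    case (Suc t)
    then have "(w t, w (Suc t)) \<in> adj edges" using edgeI by simp
    then show ?case using Suc by (meson Suc_leD rtrancl.rtrancl_into_rtrancl)
  qed
  have reach: "(n, v) \<in> (adj edges)\<^sup>*" if v: "v \<in> {1..n}" for v
  proof (cases "v = n")
    case False
    then have "v \<in> {1..<n}" using v by auto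
    then obtain s e where "e < 2 * n - 2" "w e = v" using moves_pair by metis
    then show ?thesis using walk[of e] by simp
  qed simp
  have "card {1..n} \<le> Suc (card edges)"
    using fin reach adj_rtrancl_sym n_ge
    by (intro card_vertices_le_Suc_card_edges[where r = n]) auto
  then have "card edges = n - 1" using card_edges_le by simp
  moreover have "(u, v) \<in> (adj edges)\<^sup>*" if "u \<in> {1..n}" "v \<in> {1..n}" for u v
    using reach that adj_rtrancl_sym by (meson rtrancl_trans)
  moreover have "\<exists>u v. x = {u, v} \<and> u \<noteq> v \<and> u \<in> {1..n} \<and> v \<in> {1..n}" if "x \<in> edges" for x
    using that w_neq walk_range unfolding edges_def by blast
  ultimately show ?thesis unfolding is_tree_def by blast
qed

lemma tour_edges: "tour n edges w"
proof -
  interpret labeled_tree n edges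
    using n_ge is_tree_edges by unfold_locales
  have im: "(\<lambda>t. (w t, w (Suc t))) ` {..<2 * n - 2} = adj edges"
  proof
    show "(\<lambda>t. (w t, w (Suc t))) ` {..<2 * n - 2} \<subseteq> adj edges"
      by (rule image_subsetI) (simp add: edgeI)
    show "adj edges \<subseteq> (\<lambda>t. (w t, w (Suc t))) ` {..<2 * n - 2}"
    proof
      fix p assume "p \<in> adj edges"
      then obtain u v where p: "p = (u, v)" "{u, v} \<in> edges" by (cases p) simp
      then obtain t where t: "t < 2 * n - 2" "{u, v} = {w t, w (Suc t)}"
        unfolding edges_def by blast
      obtain r where "r < 2 * n - 2" "w r = w (Suc t)" "w (Suc r) = w t"
        using reverse_step[OF t(1)] .
      then have "(w t, w (Suc t)) \<in> (\<lambda>t. (w t, w (Suc t))) ` {..<2 * n - 2}"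
        "(w (Suc t), w t) \<in> (\<lambda>t. (w t, w (Suc t))) ` {..<2 * n - 2}"
        using t(1) by (auto intro: image_eqI[of _ _ t] image_eqI[of _ _ r])
      then show "p \<in> (\<lambda>t. (w t, w (Suc t))) ` {..<2 * n - 2}"
        using t(2) unfolding p(1) doubleton_eq_iff by auto
    qed
  qed
  \<comment> \<open>There are as many times as darts, so covering every dart already forces
    injectivity.\<close>
  have "inj_on (\<lambda>t. (w t, w (Suc t))) {..<2 * n - 2}"
    by (rule eq_card_imp_inj_on) (simp_all add: im card_adj)
  then show ?thesis
    using im w_0 w_end by unfold_locales (simp_all add: bij_betw_def)
qed

sublocale tour n edges w
  by (rule tour_edges)

text \<open>A length strictly between 0 and \<open>n\<close> is determined by the classes it joins,
  so each factor has the normal form used by \<open>rT_step\<close>.\<close>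

lemma steps_eq: "steps = rs"
proof (rule nth_equalityI)
  fix t assume "t < length steps"
  then have t: "t < 2 * n - 2" by (simp add: steps_def)
  have "d t < int n" using reverse_step[OF t] by blast
  then have d: "d t = gap n (w t) (w (Suc t))"
    by (rule gap_unique[OF d_pos[OF t] _ d_mod[OF t] walk_range walk_range w_neq[OF t]])
  have "rs ! t = arefl n (int (w t)) (int (w t) + d t)"
    unfolding factor(3)[OF t] using w_a[OF t] by (intro arefl_cong) (simp_all add: d_def)
  then show "steps ! t = rs ! t" using t d by (simp add: steps_def rT_step_arefl)
qed (simp add: steps_def len)

end

section \<open>Surjectivity and the bijection\<close>

lemma cyclic_fact_imp_rT:
  assumes "2 \<le> n" "cyclic_fact n rs"
  obtains E where "is_tree n E" "rs = rT n E"
proof -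
  obtain a b where fact: "is_fact n rs" and wit: "tree_like_wit n rs a b"
    and root: "sorted_wrt (<) (Nlist n (length rs) a b (int n))"
    and nonroot: "\<And>k. 1 \<le> k \<and> k < n \<Longrightarrow> cyc_cond (Nlist n (length rs) a b (int k)) (int k)"
    using assms(2) unfolding cyclic_fact_def by blast
  interpret tree_like_factorization n rs a b
    using assms(1) fact wit by unfold_locales
  have N: "Nlist n (length rs) a b (int k) = map int (outs k)" if "k \<in> {1..n}" for k
    unfolding len by (rule Nlist_outs) (use w_a w_b that in auto)
  have clockwise
    unfolding clockwise_iff using root nonroot N assms(1) by simp
  then have "rs = rT n edges" using clockwise_steps steps_eq by simp
  then show ?thesis using that is_tree_edges by blast
qed

theorem theorem4p8:
  fixes n :: nat
  assumes "n \<ge> 2"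
  shows "(\<forall>E. is_tree n E \<longrightarrow> cyclic_fact n (rT n E)) \<and>
         bij_betw (rT n) {E. is_tree n E} {rs. cyclic_fact n rs}"
proof -
  have cyclic: "cyclic_fact n (rT n E)" if "is_tree n E" for E
    using labeled_tree.cyclic_fact_rT labeled_tree.intro assms that by blast
  moreover have "rT n ` {E. is_tree n E} = {rs. cyclic_fact n rs}"
    using cyclic cyclic_fact_imp_rT[OF assms] by blast
  ultimately show ?thesis using inj_on_rT[OF assms] unfolding bij_betw_def by blast
qed

end
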